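(* A Cosserat continuum $\mathcal{B}$ is homogeneous (resp. locally homogeneous) if, and only if, there exists a reference crystal $\overline{Z}_{0}\in\overline F^2\mathcal B$ such that $\mathcal{B}$ is homogeneous (resp. locally homogeneous) with respect to $\overline{Z}_{0}$.
   Context: Frame bundles. For an $n$-manifold $M$, $FM\to M$ is the linear frame bundle with its right action of $Gl(n,\mathbb R)$; a frame at $x$ is a $1$-jet $j^1_{0,x}\phi$ of a local diffeomorphism $\phi:\mathbb R^n\to M$ with $\phi(0)=x$. For a local diffeomorphism $\psi$, $F\psi(j^1_{0,\phi(0)}\phi)=j^1_{0,\psi(\phi(0))}(\psi\circ\phi)$. $\tau_v$ is translation of $\mathbb R^n$ by $v$; $e_1=j^1_{0,0}\mathrm{Id}\in F\mathbb R^n$. A local principal bundle isomorphism is a diffeomorphism $\Psi$ between open restrictions of frame bundles with $\Psi(z\cdot g)=\Psi(z)\cdot g$; it induces a map $\psi$ of bases. The second-order non-holonomic frame bundle $\overline F^2M$ is the set of $1$-jets $j^1_{e_1,\Psi(e_1)}\Psi$ of local principal bundle isomorphisms $\Psi:F\mathbb R^n\to FM$ defined at $e_1$; its element $j^1_{e_1,\Psi(e_1)}\Psi$ is a frame at $\psi(0)$. $\tilde J^1(FM)\rightrightarrows M$ is the quotient of the groupoid of $1$-jets $j^1_{X,Y}\Psi$ of local principal bundle isomorphisms of $FM$ by the action $j^1_{X,Y}\Psi\cdot g=j^1_{X\cdot g,Y\cdot g}\Psi$ of $Gl(n,\mathbb R)$; the class of $j^1_{X,Y}\Psi$, with $X$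 over $x$ and $Y$ over $y$, is written $j^1_{x,y}\Psi$ (source $x$, target $y$). An element $L$ with source $z_0$ composes with a frame $\overline Z_0=j^1_{e_1,Z_0}\Phi\in\overline F^2M$ at $z_0$ by using the representative of $L$ with source $Z_0$. Cosserat media. A body $\mathcal B$ is a $3$-manifold covered by one chart; a Cosserat medium is $F\mathcal B$ (and $\mathcal B$ is called the Cosserat continuum). A configuration is an embedding of principal bundles $F\mathcal B\to F\mathbb R^3$ over the identity of $Gl(3,\mathbb R)$. A reference configuration is fixed and $F\mathcal B$ is identified with its image, so $\mathcal B\subseteq\mathbb R^3$ is open. A deformation is an embedding of principal bundles $\tilde\kappa:F\mathcal B\to F\mathbb R^3$ over the identity of $Gl(3,\mathbb R)$, with induced map $\kappa:\mathcal B\to\mathbb R^3$; $j^1_{y,\kappa(y)}\tilde\kappa$ is an infinitesimal deformation at $y$. The mechanical response is a differentiable map $W:\tilde J^1(F\mathcal B)\to V$ ($V$ a real vector space) with $W(j^1_{x,y}\Psi)=W(j^1_{x,z}(F\tau_{z-y}\circ\Psi))$; by this property $W$ is also defined on elements of $\tilde J^1(F\mathbb R^3)$ with source in $\mathcal B$. The material groupoid $\overline\Omega(\mathcal B)$ consists of the $j^1_{x,y}\Psi\in\tilde J^1(F\mathcal B)$ with $W(j^1_{y,\kappa(y)}\tilde\kappa\cdot j^1_{x,y}\Psi)=W(j^1_{y,\kappa(y)}\tilde\kappa)$ for all infinitesimal deformations at $y$. Standing assumption: $\overline\Omega(\mathcal B)$ is a Lie subgroupoid of $\tilde J^1(F\mathcal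 B)$. Homogeneity. $\mathcal B$ is homogeneous if there is a global deformation $\tilde\kappa$ such that for all $x,y\in\mathcal B$, $j^1_{x,y}(\tilde\kappa^{-1}\circ F\tau_{\kappa(y)-\kappa(x)}\circ\tilde\kappa)\in\overline\Omega(\mathcal B)$. An open $U\subseteq\mathcal B$ is homogeneous if the same holds with a deformation defined over $U$ and $x,y\in U$. $\mathcal B$ is locally homogeneous if it is covered by homogeneous open sets. Homogeneity with respect to a reference crystal. A reference crystal is a frame $\overline Z_0\in\overline F^2\mathcal B$ at some $z_0\in\mathcal B$. Put $\overline\omega_{\overline G_0}(\mathcal B)=\overline\Omega_{z_0}(\mathcal B)\cdot\overline Z_0\subseteq\overline F^2\mathcal B$, where $\overline\Omega_{z_0}(\mathcal B)$ is the set of elements of $\overline\Omega(\mathcal B)$ with source $z_0$. $\mathcal B$ is homogeneous with respect to $\overline Z_0$ if there is a global deformation $\tilde\kappa$, with induced map $\kappa$, such that $\overline P(x)=j^1_{e_1,X}(\tilde\kappa^{-1}\circ F\tau_{\kappa(x)})$, with $X=\tilde\kappa^{-1}(F\tau_{\kappa(x)}(e_1))$, belongs to $\overline\omega_{\overline G_0}(\mathcal B)$ for every $x\in\mathcal B$. $\mathcal B$ is locally homogeneous with respect to $\overline Z_0$ if every point has an open neighbourhood $U$ on which the same holds with a deformation defined over $U$ and $x\in U$.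
   Formalization: The body is assumed nonempty, and connected for the implication from locally homogeneous to existence of a reference crystal; without connectedness it fails, e.g. for two disjoint balls with W a different constant on each. *)

theory Defs
  imports "HOL-Analysis.Analysis"
begin

subsection \<open>Smooth maps\<close>

primrec k_smooth :: "nat \<Rightarrow> 'a::real_normed_vector set \<Rightarrow> ('a \<Rightarrow> 'b::real_normed_vector) \<Rightarrow> bool" where
  "k_smooth 0 S f \<longleftrightarrow> continuous_on S f"
| "k_smooth (Suc k) S f \<longleftrightarrow>
     (\<forall>x\<in>S. f differentiable (at x)) \<and> (\<forall>v. k_smooth k S (\<lambda>x. frechet_derivative f (at x) v))"

text \<open>\<^const>\<open>k_smooth\<close> is meant for open sets. On an arbitrary subset of a vector space, smooth
  (\<open>C\<^sup>\<infinity>\<close>) means: locally the restriction of a smooth map defined on an open set.\<close>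

definition smooth_on :: "'a::real_normed_vector set \<Rightarrow> ('a \<Rightarrow> 'b::real_normed_vector) \<Rightarrow> bool" where
  "smooth_on S f \<longleftrightarrow>
     (\<forall>x\<in>S. \<exists>N g. open N \<and> x \<in> N \<and> (\<forall>k. k_smooth k N g) \<and> (\<forall>y\<in>N \<inter> S. g y = f y))"

definition diffeo :: "'a::real_normed_vector set \<Rightarrow> 'b::real_normed_vector set \<Rightarrow> ('a \<Rightarrow> 'b) \<Rightarrow> bool" where
  "diffeo S T f \<longleftrightarrow> bij_betw f S T \<and> smooth_on S f \<and> smooth_on T (inv_into S f)"

definition smooth_embedding :: "'a::real_normed_vector set \<Rightarrow> ('a \<Rightarrow> 'b::real_normed_vector) \<Rightarrow> bool" where
  "smooth_embedding S f \<longleftrightarrow> diffeo S (f ` S) f"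


subsection \<open>Frame bundles of open subsets of Euclidean space\<close>

text \<open>The \<open>1\<close>-jet \<open>j\<^sup>1\<^bsub>0,x\<^esub> \<phi>\<close> is recorded as the pair of \<open>x = \<phi> 0\<close> and the Jacobian matrix of \<open>\<phi>\<close>
  at \<open>0\<close>, so that frame bundles are subsets of a vector space.\<close>

type_synonym 'n frame = "(real, 'n) vec \<times> ((real, 'n) vec, 'n) vec"

definition frame_of :: "(real^'n \<Rightarrow> real^'n) \<Rightarrow> 'n::finite frame" where
  "frame_of \<phi> = (\<phi> 0, matrix (frechet_derivative \<phi> (at 0)))"

definition frame_bundle :: "(real^'n) set \<Rightarrow> 'n::finite frame set" where
  "frame_bundle U =
     {frame_of \<phi> | \<phi> N N'. open N \<and> open N' \<and> 0 \<in> N \<and> diffeo N N' \<phi> \<and> \<phi> 0 \<in> U}"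

text \<open>In terms of jets, \<open>j\<^sup>1\<^bsub>0,x\<^esub> \<phi> \<cdot> g = j\<^sup>1\<^bsub>0,x\<^esub> (\<phi> \<circ> g)\<close>, and \<open>F\<psi>\<close> sends \<open>j\<^sup>1\<^bsub>0,x\<^esub> \<phi>\<close> to the
  \<open>1\<close>-jet of \<open>\<psi> \<circ> \<phi>\<close>.\<close>

definition frame_act :: "'n::finite frame \<Rightarrow> real^'n^'n \<Rightarrow> 'n frame" where
  "frame_act X g = (fst X, snd X ** g)"

definition frame_lift :: "(real^'n \<Rightarrow> real^'n) \<Rightarrow> 'n::finite frame \<Rightarrow> 'n frame" where
  "frame_lift \<psi> X = (\<psi> (fst X), matrix (frechet_derivative \<psi> (at (fst X))) ** snd X)"

abbreviation translation :: "real^'n \<Rightarrow> real^'n \<Rightarrow> real^'n::finite" where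
  "translation v \<equiv> (\<lambda>x. x + v)"

definition e1 :: "'n::finite frame" where
  "e1 = frame_of (\<lambda>x. x)"

lemma k_smooth_const: "k_smooth k S (\<lambda>x. c)"
  by (induction k arbitrary: c) auto

lemma k_smooth_affine:
  assumes "bounded_linear f"
  shows "k_smooth k S (\<lambda>x. c + f x)"
proof -
  have d: "((\<lambda>x. c + f x) has_derivative f) (at x)" for x
    by (auto intro!: derivative_eq_intros bounded_linear_imp_has_derivative assms)
  have fd: "frechet_derivative (\<lambda>x. c + f x) (at x) = f" for x
    using frechet_derivative_at[OF d] by simp
  have "continuous_on S (\<lambda>x. c + f x)"
    by (intro continuous_intros linear_continuous_on assms)
  moreover have "(\<lambda>x. c + f x) differentiable (at x)" for x
    using d differentiable_def by blast
  ultimately show ?thesis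
    by (cases k) (auto simp: fd k_smooth_const)
qed

lemma diffeo_derivative_invertible:
  fixes f :: "real^'n \<Rightarrow> real^'n"
  assumes "open S" "open T" "diffeo S T f" "x \<in> S"
  shows "f differentiable (at x)" "invertible (matrix (frechet_derivative f (at x)))"
proof -
  have *: "h differentiable (at z)" if h: "smooth_on A h" "open A" "z \<in> A"
    for h :: "real^'n \<Rightarrow> real^'n" and A z
  proof -
    obtain N g where g: "open N" "z \<in> N" "k_smooth (Suc 0) N g" "\<forall>y\<in>N \<inter> A. g y = h y"
      using h unfolding smooth_on_def by metis
    then obtain D where "(g has_derivative D) (at z)"
      by (auto simp: differentiable_def)
    then have "(h has_derivative D) (at z)"
      using has_derivative_transform_within_open[of g D z UNIV "N \<inter> A" h] g h by auto
    then show ?thesis by (auto simp: differentiable_def)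
  qed
  show df: "f differentiable (at x)"
    using assms * by (auto simp: diffeo_def)
  let ?g = "inv_into S f"
  have bij: "bij_betw f S T" using assms by (simp add: diffeo_def)
  have fx: "f x \<in> T" using bij assms by (auto simp: bij_betw_def)
  have dg: "?g differentiable (at (f x))"
    using assms fx * by (auto simp: diffeo_def)
  let ?F = "frechet_derivative f (at x)" and ?G = "frechet_derivative ?g (at (f x))"
  have F: "(f has_derivative ?F) (at x)" and G: "(?g has_derivative ?G) (at (f x))"
    using df dg frechet_derivative_works by blast+
  have "((\<lambda>y. ?g (f y)) has_derivative (\<lambda>v. ?G (?F v))) (at x)"
    using diff_chain_at[OF F G] by (simp add: o_def)
  moreover have "((\<lambda>y. ?g (f y)) has_derivative (\<lambda>v. v)) (at x)"
    by (rule has_derivative_transform_within_open[of "\<lambda>y. y" _ x UNIV S])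
       (use assms bij in \<open>auto simp: bij_betw_def\<close>)
  ultimately have "(\<lambda>v. ?G (?F v)) = (\<lambda>v. v)"
    using has_derivative_unique by blast
  moreover have "linear ?F" "linear ?G"
    using F G has_derivative_linear by blast+
  ultimately have "matrix ?G ** matrix ?F = mat 1"
    using matrix_compose[of ?F ?G] by (simp add: o_def matrix_id_mat_1[unfolded id_def])
  then show "invertible (matrix ?F)"
    using matrix_left_right_inverse by (auto simp: invertible_def)
qed

lemma frame_bundle_iff: "(x, Z) \<in> frame_bundle U \<longleftrightarrow> x \<in> U \<and> invertible Z"
proof
  assume "(x, Z) \<in> frame_bundle U"
  then show "x \<in> U \<and> invertible Z"
    using diffeo_derivative_invertible(2)
    by (fastforce simp: frame_bundle_def frame_of_def)
next
  assume *: "x \<in> U \<and> invertible Z"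
  then obtain Z' where Z': "Z ** Z' = mat 1" "Z' ** Z = mat 1"
    by (auto simp: invertible_def)
  let ?f = "\<lambda>v. x + Z *v v" and ?g = "\<lambda>y. - (Z' *v x) + Z' *v y"
  have gf: "?g (?f v) = v" and fg: "?f (?g v) = v" for v
    using matrix_vector_mult_diff_distrib[of Z "Z' *v v" "Z' *v x"]
    by (simp_all add: matrix_vector_right_distrib matrix_vector_mul_assoc Z')
  have bij: "bij_betw ?f UNIV UNIV"
    by (rule bij_betw_byWitness[where f' = ?g]) (use gf fg in auto)
  then have inv: "inv_into UNIV ?f = ?g"
    using fg by (metis (no_types, lifting) ext UNIV_I bij_betw_inv_into_left)
  have sm: "smooth_on UNIV (\<lambda>v. c + A *v v)" for c :: "real^'a" and A :: "real^'a^'a"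
    unfolding smooth_on_def
    using k_smooth_affine[of "(*v) A" _ UNIV c] open_UNIV by blast
  have "diffeo UNIV UNIV ?f"
    unfolding diffeo_def inv by (intro conjI bij sm)
  moreover have "(?f has_derivative (\<lambda>v. Z *v v)) (at 0)"
    by (auto intro!: derivative_eq_intros bounded_linear_imp_has_derivative)
  then have "frechet_derivative ?f (at 0) = (\<lambda>v. Z *v v)"
    using frechet_derivative_at by metis
  then have "frame_of ?f = (x, Z)"
    by (simp add: frame_of_def matrix_of_matrix_vector_mul)
  ultimately show "(x, Z) \<in> frame_bundle U"
    using * unfolding frame_bundle_def mem_Collect_eq
    by (intro exI[of _ ?f] exI[of _ UNIV]) auto
qed

lemma frame_lift_translation: "frame_lift (translation v) (x, Z) = (x + v, Z)"
proof -
  have "(translation v has_derivative (\<lambda>u. u)) (at x)"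
    by (auto intro!: derivative_eq_intros)
  then have "frechet_derivative (translation v) (at x) = (\<lambda>u. u)"
    using frechet_derivative_at by metis
  then show ?thesis
    by (simp add: frame_lift_def matrix_id_mat_1[unfolded id_def])
qed

lemma e1_eq: "e1 = (0, mat 1)"
  by (simp add: e1_def frame_of_def matrix_id_mat_1[unfolded id_def])


subsection \<open>Principal bundle morphisms and their jets\<close>

definition principal_embedding :: "(real^'n) set \<Rightarrow> ('n::finite frame \<Rightarrow> 'n frame) \<Rightarrow> bool" where
  "principal_embedding U \<Psi> \<longleftrightarrow>
     \<Psi> ` frame_bundle U \<subseteq> frame_bundle UNIV \<and>
     smooth_embedding (frame_bundle U) \<Psi> \<and>
     (\<forall>X\<in>frame_bundle U. \<forall>g. invertible g \<longrightarrow> \<Psi> (frame_act X g) = frame_act (\<Psi> X) g)"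

definition principal_iso ::
    "(real^'n) set \<Rightarrow> (real^'n) set \<Rightarrow> ('n::finite frame \<Rightarrow> 'n frame) \<Rightarrow> bool" where
  "principal_iso U V \<Psi> \<longleftrightarrow>
     open U \<and> open V \<and> diffeo (frame_bundle U) (frame_bundle V) \<Psi> \<and>
     (\<forall>X\<in>frame_bundle U. \<forall>g. invertible g \<longrightarrow> \<Psi> (frame_act X g) = frame_act (\<Psi> X) g)"

text \<open>The induced map on the base, which by equivariance may be computed on any frame.\<close>

definition base_map :: "('n::finite frame \<Rightarrow> 'n frame) \<Rightarrow> real^'n \<Rightarrow> real^'n" where
  "base_map \<Psi> x = fst (\<Psi> (x, mat 1))"

text \<open>The \<open>1\<close>-jet \<open>j\<^sup>1\<^bsub>X,Y\<^esub> \<Psi>\<close> is recorded as the triple of \<open>X\<close>, \<open>Y = \<Psi> X\<close> and the derivative at \<open>X\<close>.\<close>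

type_synonym 'n jet = "'n frame \<times> 'n frame \<times> ('n frame \<Rightarrow> 'n frame)"

definition jet1 :: "('n::finite frame \<Rightarrow> 'n frame) \<Rightarrow> 'n frame \<Rightarrow> 'n jet" where
  "jet1 \<Psi> X = (X, \<Psi> X, frechet_derivative \<Psi> (at X))"

text \<open>The class \<open>j\<^sup>1\<^bsub>x,y\<^esub> \<Psi>\<close>: since \<open>j\<^sup>1\<^bsub>X,Y\<^esub> \<Psi> \<cdot> g = j\<^sup>1\<^bsub>X\<cdot>g,Y\<cdot>g\<^esub> \<Psi>\<close> and the fibre over \<open>x\<close> is a single orbit,
  the orbit of \<open>j\<^sup>1\<^bsub>X,Y\<^esub> \<Psi>\<close> consists of the jets of \<open>\<Psi>\<close> at all frames over \<open>x\<close>.\<close>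

definition jet_class :: "('n::finite frame \<Rightarrow> 'n frame) \<Rightarrow> real^'n \<Rightarrow> 'n jet set" where
  "jet_class \<Psi> x = jet1 \<Psi> ` frame_bundle {x}"

definition jet_groupoid :: "(real^'n) set \<Rightarrow> 'n::finite jet set set" where
  "jet_groupoid B =
     {jet_class \<Psi> x | \<Psi> U V x. principal_iso U V \<Psi> \<and> U \<subseteq> B \<and> V \<subseteq> B \<and> x \<in> U}"

definition jet_source :: "'n::finite jet set \<Rightarrow> real^'n" where
  "jet_source L = the_elem ((\<lambda>(X, Y, D). fst X) ` L)"

definition jet_target :: "'n::finite jet set \<Rightarrow> real^'n" where
  "jet_target L = the_elem ((\<lambda>(X, Y, D). fst Y) ` L)"

text \<open>Composition by matching representatives. It is written for arbitrary sets of jets: for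
  a single second-order frame \<open>Z\<close>, \<open>jet_comp L {Z}\<close> is the singleton of \<open>L \<cdot> Z\<close>.\<close>

definition jet_comp :: "'n::finite jet set \<Rightarrow> 'n jet set \<Rightarrow> 'n jet set" where
  "jet_comp M L = {(X, Z, D' \<circ> D) | X Y Z D D'. (X, Y, D) \<in> L \<and> (Y, Z, D') \<in> M}"

definition jet_inv :: "'n::finite jet set \<Rightarrow> 'n jet set" where
  "jet_inv L = {(Y, X, inv D) | X Y D. (X, Y, D) \<in> L}"

definition second_frame_bundle :: "(real^'n) set \<Rightarrow> 'n::finite jet set" where
  "second_frame_bundle B =
     {jet1 \<Psi> e1 | \<Psi> U V. principal_iso U V \<Psi> \<and> 0 \<in> U \<and> V \<subseteq> B}"

definition second_frame_base :: "'n::finite jet \<Rightarrow> real^'n" where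
  "second_frame_base Z = fst (fst (snd Z))"


subsection \<open>The smooth structure of the groupoid of jets\<close>

text \<open>A local principal bundle isomorphism has the form \<open>(u, Z) \<mapsto> (\<psi> u, H u ** Z)\<close>, and its class at \<open>x\<close>
  is determined by \<open>x\<close>, \<open>y = \<psi> x\<close>, the Jacobian matrix \<open>P\<close> of \<open>\<psi>\<close> at \<open>x\<close>, the matrix \<open>A = H x\<close> and the
  partial derivatives \<open>C $ k\<close> of \<open>H\<close> at \<open>x\<close>. These are global coordinates on the groupoid of jets.\<close>

type_synonym 'n jet_coord =
  "(real, 'n) vec \<times> (real, 'n) vec \<times> ((real, 'n) vec, 'n) vec \<times> ((real, 'n) vec, 'n) vec \<times>
   (((real, 'n) vec, 'n) vec, 'n) vec"

fun jet_of_coord :: "'n::finite jet_coord \<Rightarrow> 'n jet set" where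
  "jet_of_coord (x, y, P, A, C) =
     jet_class (\<lambda>(u, Z). (y + P *v (u - x), (A + (\<Sum>k\<in>UNIV. ((u - x) $ k) *\<^sub>R (C $ k))) ** Z)) x"

definition jet_coord_domain :: "(real^'n) set \<Rightarrow> 'n::finite jet_coord set" where
  "jet_coord_domain B = {(x, y, P, A, C). x \<in> B \<and> y \<in> B \<and> invertible P \<and> invertible A}"

definition jet_coord :: "(real^'n) set \<Rightarrow> 'n::finite jet set \<Rightarrow> 'n jet_coord" where
  "jet_coord B = inv_into (jet_coord_domain B) jet_of_coord"

text \<open>Immersed submanifolds \<open>S\<close> of a vector space, given by a countable atlas \<open>\<A>\<close> of smooth injective
  immersions \<open>p\<close> of open subsets \<open>G\<close> of a fixed linear subspace \<open>H\<close>, whose dimension is that of the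
  submanifold. The topology of \<open>S\<close> may be finer than the subspace topology.\<close>

definition smooth_into ::
    "('h::real_normed_vector set \<times> ('h \<Rightarrow> 'e)) set \<Rightarrow> 't::real_normed_vector set \<Rightarrow>
     ('t \<Rightarrow> 'e::real_normed_vector) \<Rightarrow> bool" where
  "smooth_into \<A> T f \<longleftrightarrow>
     (\<forall>(G, p)\<in>\<A>. openin (top_of_set T) {t\<in>T. f t \<in> p ` G} \<and>
        smooth_on {t\<in>T. f t \<in> p ` G} (inv_into G p \<circ> f))"

definition immersed_submanifold ::
    "'e::euclidean_space set \<Rightarrow> ('e set \<times> ('e \<Rightarrow> 'e)) set \<Rightarrow> 'e set \<Rightarrow> bool" where
  "immersed_submanifold H \<A> S \<longleftrightarrow>
     subspace H \<and> countable \<A> \<and> (\<Union>(G, p)\<in>\<A>. p ` G) = S \<and>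
     (\<forall>(G, p)\<in>\<A>. openin (top_of_set H) G \<and> inj_on p G \<and> smooth_on G p \<and>
        (\<forall>q\<in>G. \<exists>D. (p has_derivative D) (at q within G) \<and> inj_on D H) \<and>
        smooth_into \<A> G p)"

definition submersion ::
    "'e::real_normed_vector set \<Rightarrow> 'e set \<Rightarrow> ('e \<Rightarrow> 'b::real_normed_vector) \<Rightarrow> bool" where
  "submersion H G f \<longleftrightarrow> (\<forall>q\<in>G. \<exists>D. (f has_derivative D) (at q within G) \<and> D ` H = UNIV)"

definition wide_subgroupoid :: "(real^'n) set \<Rightarrow> 'n::finite jet set set \<Rightarrow> bool" where
  "wide_subgroupoid B \<Omega> \<longleftrightarrow>
     \<Omega> \<subseteq> jet_groupoid B \<and>
     (\<forall>x\<in>B. jet_class id x \<in> \<Omega>) \<and>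
     (\<forall>L\<in>\<Omega>. jet_inv L \<in> \<Omega>) \<and>
     (\<forall>L\<in>\<Omega>. \<forall>M\<in>\<Omega>. jet_source M = jet_target L \<longrightarrow> jet_comp M L \<in> \<Omega>)"

text \<open>The first two coordinates are the source and the target. All structure maps are smooth
  for the given immersed submanifold structure.\<close>

definition lie_subgroupoid :: "(real^'n) set \<Rightarrow> 'n::finite jet set set \<Rightarrow> bool" where
  "lie_subgroupoid B \<Omega> \<longleftrightarrow>
     wide_subgroupoid B \<Omega> \<and>
     (\<exists>H \<A>. immersed_submanifold H \<A> (jet_coord B ` \<Omega>) \<and>
        (\<forall>(G, p)\<in>\<A>. submersion H G (\<lambda>q. fst (p q)) \<and> submersion H G (\<lambda>q. fst (snd (p q))) \<and>
           smooth_into \<A> G (\<lambda>q. jet_coord B (jet_inv (jet_of_coord (p q))))) \<and>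
        smooth_into \<A> B (\<lambda>x. jet_coord B (jet_class id x)) \<and>
        (\<forall>(G, p)\<in>\<A>. \<forall>(G', p')\<in>\<A>.
           smooth_into \<A> {(q, q'). q \<in> G \<and> q' \<in> G' \<and> fst (p q) = fst (snd (p' q'))}
             (\<lambda>(q, q'). jet_coord B (jet_comp (jet_of_coord (p q)) (jet_of_coord (p' q'))))))"


subsection \<open>Cosserat media\<close>

text \<open>The reference configuration identifies the body with an open set \<open>B\<close>.\<close>

definition deformation :: "(real^'n) set \<Rightarrow> ('n::finite frame \<Rightarrow> 'n frame) \<Rightarrow> bool" where
  "deformation U \<kappa> \<longleftrightarrow> principal_embedding U \<kappa>"

definition mechanical_response ::
    "(real^'n) set \<Rightarrow> ('n::finite jet set \<Rightarrow> 'v::real_normed_vector) \<Rightarrow> bool" where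
  "mechanical_response B W \<longleftrightarrow>
     (\<lambda>c. W (jet_of_coord c)) differentiable_on jet_coord_domain B \<and>
     (\<forall>\<Psi> U V x z. principal_iso U V \<Psi> \<and> U \<subseteq> B \<and> V \<subseteq> B \<and> x \<in> U \<and> z \<in> B \<longrightarrow>
        W (jet_class \<Psi> x) =
        W (jet_class (frame_lift (translation (z - base_map \<Psi> x)) \<circ> \<Psi>) x))"

text \<open>The value of \<open>W\<close> on a jet with source in the body and arbitrary target: the target is
  translated to the source. By the invariance of \<open>W\<close>, any other point of the body will do.\<close>

definition response_ext :: "('n::finite jet set \<Rightarrow> 'v) \<Rightarrow> 'n jet set \<Rightarrow> 'v" where
  "response_ext W L =
     W (jet_comp
         (jet_class (frame_lift (translation (jet_source L - jet_target L))) (jet_target L)) L)"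

definition material_groupoid ::
    "(real^'n) set \<Rightarrow> ('n::finite jet set \<Rightarrow> 'v::real_normed_vector) \<Rightarrow> 'n jet set set" where
  "material_groupoid B W =
     {L \<in> jet_groupoid B. \<forall>\<kappa>. deformation B \<kappa> \<longrightarrow>
        response_ext W (jet_comp (jet_class \<kappa> (jet_target L)) L) =
        response_ext W (jet_class \<kappa> (jet_target L))}"

definition homogeneous_on ::
    "(real^'n) set \<Rightarrow> ('n::finite jet set \<Rightarrow> 'v::real_normed_vector) \<Rightarrow> (real^'n) set \<Rightarrow> bool" where
  "homogeneous_on B W U \<longleftrightarrow>
     (\<exists>\<kappa>. deformation U \<kappa> \<and>
        (\<forall>x\<in>U. \<forall>y\<in>U.
           jet_class (inv_into (frame_bundle U) \<kappa> \<circ>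
                      frame_lift (translation (base_map \<kappa> y - base_map \<kappa> x)) \<circ> \<kappa>) x
             \<in> material_groupoid B W))"

definition homogeneous ::
    "(real^'n) set \<Rightarrow> ('n::finite jet set \<Rightarrow> 'v::real_normed_vector) \<Rightarrow> bool" where
  "homogeneous B W \<longleftrightarrow> homogeneous_on B W B"

definition locally_homogeneous ::
    "(real^'n) set \<Rightarrow> ('n::finite jet set \<Rightarrow> 'v::real_normed_vector) \<Rightarrow> bool" where
  "locally_homogeneous B W \<longleftrightarrow>
     (\<exists>\<U>. (\<forall>U\<in>\<U>. open U \<and> U \<subseteq> B \<and> homogeneous_on B W U) \<and> \<Union>\<U> = B)"

definition crystal_structure ::
    "(real^'n) set \<Rightarrow> ('n::finite jet set \<Rightarrow> 'v::real_normed_vector) \<Rightarrow> 'n jet \<Rightarrow> 'n jet set" where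
  "crystal_structure B W Z\<^sub>0 =
     (\<Union>L\<in>{L \<in> material_groupoid B W. jet_source L = second_frame_base Z\<^sub>0}. jet_comp L {Z\<^sub>0})"

definition homogeneous_wrt_on ::
    "(real^'n) set \<Rightarrow> ('n::finite jet set \<Rightarrow> 'v::real_normed_vector) \<Rightarrow> 'n jet \<Rightarrow>
     (real^'n) set \<Rightarrow> bool" where
  "homogeneous_wrt_on B W Z\<^sub>0 U \<longleftrightarrow>
     (\<exists>\<kappa>. deformation U \<kappa> \<and>
        (\<forall>x\<in>U. jet1 (inv_into (frame_bundle U) \<kappa> \<circ> frame_lift (translation (base_map \<kappa> x))) e1
                 \<in> crystal_structure B W Z\<^sub>0))"

definition homogeneous_wrt ::
    "(real^'n) set \<Rightarrow> ('n::finite jet set \<Rightarrow> 'v::real_normed_vector) \<Rightarrow> 'n jet \<Rightarrow> bool" where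
  "homogeneous_wrt B W Z\<^sub>0 \<longleftrightarrow> homogeneous_wrt_on B W Z\<^sub>0 B"

definition locally_homogeneous_wrt ::
    "(real^'n) set \<Rightarrow> ('n::finite jet set \<Rightarrow> 'v::real_normed_vector) \<Rightarrow> 'n jet \<Rightarrow> bool" where
  "locally_homogeneous_wrt B W Z\<^sub>0 \<longleftrightarrow>
     (\<forall>x\<in>B. \<exists>U. open U \<and> x \<in> U \<and> U \<subseteq> B \<and> homogeneous_wrt_on B W Z\<^sub>0 U)"

end

theory Submission
  imports Defs
begin

text \<open>For a deformation \<open>\<kappa>\<close> put \<open>f\<^sub>x = \<kappa>\<^sup>-\<^sup>1 \<circ> F\<tau>\<^bsub>\<kappa>(x)\<^esub>\<close>, with \<open>\<kappa>(x)\<close> computed on the base. Since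
  \<open>(\<kappa>\<^sup>-\<^sup>1 \<circ> F\<tau>\<^bsub>\<kappa>(y)-\<kappa>(x)\<^esub> \<circ> \<kappa>) \<circ> f\<^sub>x = f\<^sub>y\<close> near \<open>e\<^sub>1\<close>, the material isomorphisms from \<open>z\<close> given by \<open>\<kappa>\<close> carry the
  crystal \<open>j\<^sup>1 f\<^sub>z\<close> to all \<open>j\<^sup>1 f\<^sub>x\<close>; conversely, if all \<open>j\<^sup>1 f\<^sub>x\<close> lie in one orbit of the material groupoid,
  then the quotients \<open>j\<^sup>1 f\<^sub>y \<cdot> (j\<^sup>1 f\<^sub>x)\<^sup>-\<^sup>1\<close> are material isomorphisms.

  Homogeneous open sets that overlap may need different crystals. For connected bodies one crystal is
  spread as follows: if \<open>\<kappa>'\<close> is adapted to \<open>Z\<^sub>0\<close> near \<open>x\<close>, and \<open>\<kappa>\<close> makes an open set containing \<open>x\<close> and \<open>y\<close>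
  homogeneous, then all jets of \<open>\<Psi> = \<kappa>\<^sup>-\<^sup>1 \<circ> F\<tau>\<^bsub>\<kappa>(y)-\<kappa>(x)\<^esub> \<circ> \<kappa>\<close> near \<open>x\<close>, and not only the one at \<open>x\<close>, are material,
  so that \<open>\<kappa>' \<circ> \<Psi>\<^sup>-\<^sup>1\<close> is adapted to \<open>Z\<^sub>0\<close> near \<open>y\<close>.\<close>

subsection \<open>Calculus of smooth maps\<close>

lemma k_smooth_SucD: "k_smooth (Suc k) S f \<Longrightarrow> k_smooth k S f"
proof (induction k arbitrary: f)
  case 0
  then show ?case
    by (auto simp: continuous_on_eq_continuous_at intro!: continuous_at_imp_continuous_on
        differentiable_imp_continuous_within)
next
  case (Suc k)
  have "k_smooth (Suc k) S (\<lambda>x. frechet_derivative f (at x) v)" for v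
    using Suc.prems by (subst (asm) k_smooth.simps) blast
  then have "k_smooth k S (\<lambda>x. frechet_derivative f (at x) v)" for v
    using Suc.IH by blast
  then show ?case using Suc.prems by simp
qed

lemma k_smooth_continuous_on: "k_smooth k S f \<Longrightarrow> continuous_on S f"
proof (induction k)
  case (Suc k)
  then show ?case using k_smooth_SucD by blast
qed simp

text \<open>\<open>frechet_derivative\<close> chooses among all derivatives at the point. Maps that
  agree near the point have the same derivatives, so the choices coincide, whether or not a
  derivative exists.\<close>

lemma frechet_derivative_cong_open:
  assumes "open N" "x \<in> N" "\<And>y. y \<in> N \<Longrightarrow> f y = g y"
  shows "frechet_derivative f (at x) = frechet_derivative g (at x)"
proof -
  have "(f has_derivative D) (at x) \<longleftrightarrow> (g has_derivative D) (at x)" for D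
    using has_derivative_transform_within_open[of f D x UNIV N g]
      has_derivative_transform_within_open[of g D x UNIV N f] assms by auto
  then show ?thesis by (simp add: frechet_derivative_def)
qed

text \<open>Continuity and differentiability at a point only see a neighbourhood, and on the open
  set \<open>N\<close> the directional derivatives of \<open>g\<close> and \<open>f\<close> agree
  again, so the hypothesis passes to them.\<close>

lemma k_smooth_local:
  assumes "\<And>x. x \<in> S \<Longrightarrow> \<exists>N g. open N \<and> x \<in> N \<and> k_smooth k N g \<and> (\<forall>y\<in>N. g y = f y)"
  shows "k_smooth k S f"
  using assms
proof (induction k arbitrary: f)
  case 0
  have "isCont f x" if "x \<in> S" for x
  proof -
    obtain N g where N: "open N" "x \<in> N" "continuous_on N g" "\<forall>y\<in>N. g y = f y"
      using 0[OF \<open>x \<in> S\<close>] by auto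
    then have "continuous_on N f" by (simp cong: continuous_on_cong)
    then show ?thesis using N by (simp add: continuous_on_eq_continuous_at)
  qed
  then show ?case by (simp add: continuous_at_imp_continuous_on)
next
  case (Suc k)
  have "f differentiable (at x)" if "x \<in> S" for x
  proof -
    obtain N g where N: "open N" "x \<in> N" "k_smooth (Suc k) N g" "\<forall>y\<in>N. g y = f y"
      using Suc.prems[OF \<open>x \<in> S\<close>] by blast
    then obtain D where "(g has_derivative D) (at x)" by (auto simp: differentiable_def)
    then have "(f has_derivative D) (at x)"
      using has_derivative_transform_within_open[of g D x UNIV N f] N by auto
    then show ?thesis by (auto simp: differentiable_def)
  qed
  moreover have "k_smooth k S (\<lambda>x. frechet_derivative f (at x) v)" for v
  proof (rule Suc.IH)
    fix x assume "x \<in> S"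
    then obtain N g where N: "open N" "x \<in> N" "k_smooth (Suc k) N g" "\<forall>y\<in>N. g y = f y"
      using Suc.prems[OF \<open>x \<in> S\<close>] by blast
    then show "\<exists>N g. open N \<and> x \<in> N \<and> k_smooth k N g \<and>
        (\<forall>y\<in>N. g y = frechet_derivative f (at y) v)"
      by (intro exI[of _ N] exI[of _ "\<lambda>y. frechet_derivative g (at y) v"])
         (simp add: frechet_derivative_cong_open[OF N(1), of _ g f])
  qed
  ultimately show ?case by simp
qed

lemma k_smooth_subset: "k_smooth k S f \<Longrightarrow> T \<subseteq> S \<Longrightarrow> k_smooth k T f"
  by (induction k arbitrary: f) (auto intro: continuous_on_subset)

text \<open>A local extension of \<open>f\<close> coincides with \<open>f\<close> on the open set
  \<open>N \<inter> S\<close>, and \<open>k_smooth\<close> is a local property.\<close>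

lemma smooth_on_open_iff:
  assumes "open S"
  shows "smooth_on S f \<longleftrightarrow> (\<forall>k. k_smooth k S f)"
proof
  assume f: "smooth_on S f"
  show "\<forall>k. k_smooth k S f"
  proof (intro allI k_smooth_local)
    fix k x assume "x \<in> S"
    then obtain N g where "open N" "x \<in> N" "k_smooth k N g" "\<forall>y\<in>N \<inter> S. g y = f y"
      using f unfolding smooth_on_def by metis
    then show "\<exists>N g. open N \<and> x \<in> N \<and> k_smooth k N g \<and> (\<forall>y\<in>N. g y = f y)"
      using \<open>x \<in> S\<close> assms by (intro exI[of _ "N \<inter> S"] exI[of _ g]) (auto intro: k_smooth_subset)
  qed
next
  assume "\<forall>k. k_smooth k S f"
  then show "smooth_on S f" using assms unfolding smooth_on_def by blast
qed

lemma smooth_on_subset: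
  assumes "smooth_on S f" "T \<subseteq> S"
  shows "smooth_on T f"
  unfolding smooth_on_def
proof
  fix x assume "x \<in> T"
  then obtain N g where *: "open N" "x \<in> N" "\<forall>k. k_smooth k N g" "\<forall>y\<in>N \<inter> S. g y = f y"
    using assms unfolding smooth_on_def by (metis subsetD)
  then have "\<forall>y\<in>N \<inter> T. g y = f y"
    using assms(2) by auto
  with * show "\<exists>N g. open N \<and> x \<in> N \<and> (\<forall>k. k_smooth k N g) \<and> (\<forall>y\<in>N \<inter> T. g y = f y)"
    by (intro exI[of _ N] exI[of _ g]) simp
qed

lemma smooth_on_cong: "(\<And>x. x \<in> S \<Longrightarrow> f x = g x) \<Longrightarrow> smooth_on S f \<longleftrightarrow> smooth_on S g"
  unfolding smooth_on_def by auto

section \<open>Smoothness from explicit derivatives; sums, products and composition\<close>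

lemma k_smooth_cong_open:
  assumes "open S" "\<And>x. x \<in> S \<Longrightarrow> f x = g x" "k_smooth k S f"
  shows "k_smooth k S g"
proof (rule k_smooth_local)
  fix x assume "x \<in> S"
  then show "\<exists>N h. open N \<and> x \<in> N \<and> k_smooth k N h \<and> (\<forall>y\<in>N. h y = g y)"
    using assms by (intro exI[of _ S] exI[of _ f]) simp
qed

text \<open>Uniqueness of derivatives replaces \<open>frechet_derivative\<close> by any explicit
  formula \<open>f'\<close>, so that the inductions below reduce to the usual derivative
  rules.\<close>

lemma k_smooth_SucI:
  assumes "open S" "\<And>x. x \<in> S \<Longrightarrow> (f has_derivative f' x) (at x)" "\<And>v. k_smooth k S (\<lambda>x. f' x v)"
  shows "k_smooth (Suc k) S f"
proof -
  have "frechet_derivative f (at x) = f' x" if "x \<in> S" for x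
    using frechet_derivative_at[OF assms(2)[OF that]] by simp
  then have "k_smooth k S (\<lambda>x. frechet_derivative f (at x) v)" for v
    by (intro k_smooth_cong_open[OF assms(1) _ assms(3)[of v]]) simp
  then show ?thesis using assms(2) by (auto simp: differentiable_def)
qed

lemma k_smooth_Suc_derivative:
  assumes "k_smooth (Suc k) S f"
  shows "\<exists>f'. (\<forall>x\<in>S. (f has_derivative f' x) (at x)) \<and> (\<forall>v. k_smooth k S (\<lambda>x. f' x v))"
  using assms by (intro exI[of _ "\<lambda>x. frechet_derivative f (at x)"]) (auto simp: frechet_derivative_works)

lemma k_smooth_add:
  assumes "open S" "k_smooth k S f" "k_smooth k S g"
  shows "k_smooth k S (\<lambda>x. f x + g x)"
  using assms(2,3)
proof (induction k arbitrary: f g)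
  case 0
  then show ?case by (auto intro: continuous_intros)
next
  case (Suc k)
  obtain f' where f: "\<And>x. x \<in> S \<Longrightarrow> (f has_derivative f' x) (at x)" "\<And>v. k_smooth k S (\<lambda>x. f' x v)"
    using k_smooth_Suc_derivative[OF Suc.prems(1)] by blast
  obtain g' where g: "\<And>x. x \<in> S \<Longrightarrow> (g has_derivative g' x) (at x)" "\<And>v. k_smooth k S (\<lambda>x. g' x v)"
    using k_smooth_Suc_derivative[OF Suc.prems(2)] by blast
  show ?case
    by (rule k_smooth_SucI[OF assms(1) has_derivative_add[OF f(1) g(1)]]) ((assumption | intro Suc.IH f g)+)
qed

lemma k_smooth_sum:
  assumes "open S" "\<And>i. i \<in> I \<Longrightarrow> k_smooth k S (f i)"
  shows "k_smooth k S (\<lambda>x. \<Sum>i\<in>I. f i x)"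
  using assms(2)
  by (induction I rule: infinite_finite_induct) (auto intro: k_smooth_add k_smooth_const assms(1))

lemma k_smooth_scaleR:
  assumes "open S" "k_smooth k S f" "k_smooth k S g"
  shows "k_smooth k S (\<lambda>x. f x *\<^sub>R g x)"
  using assms(2,3)
proof (induction k arbitrary: f g)
  case 0
  then show ?case by (auto intro: continuous_intros)
next
  case (Suc k)
  obtain f' where f: "\<And>x. x \<in> S \<Longrightarrow> (f has_derivative f' x) (at x)" "\<And>v. k_smooth k S (\<lambda>x. f' x v)"
    using k_smooth_Suc_derivative[OF Suc.prems(1)] by blast
  obtain g' where g: "\<And>x. x \<in> S \<Longrightarrow> (g has_derivative g' x) (at x)" "\<And>v. k_smooth k S (\<lambda>x. g' x v)"
    using k_smooth_Suc_derivative[OF Suc.prems(2)] by blast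
  \<comment> \<open>The product rule leaves \<open>f\<close> and \<open>g\<close> undifferentiated
    in one term each, so their smoothness is also needed at the lower order
    \<open>k\<close>.\<close>
  show ?case
    by (rule k_smooth_SucI[OF assms(1) has_derivative_scaleR[OF f(1) g(1)]])
       ((assumption | intro Suc.IH k_smooth_add assms(1) f g k_smooth_SucD[OF Suc.prems(1)] k_smooth_SucD[OF Suc.prems(2)])+)
qed

lemma k_smooth_bounded_linear:
  assumes "open S" "k_smooth k S f" "bounded_linear h"
  shows "k_smooth k S (\<lambda>x. h (f x))"
  using assms(2)
proof (induction k arbitrary: f)
  case 0
  then show ?case using bounded_linear.continuous_on[OF assms(3)] by auto
next
  case (Suc k)
  obtain f' where f: "\<And>x. x \<in> S \<Longrightarrow> (f has_derivative f' x) (at x)" "\<And>v. k_smooth k S (\<lambda>x. f' x v)"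
    using k_smooth_Suc_derivative[OF Suc.prems(1)] by blast
  show ?case
    by (rule k_smooth_SucI[OF assms(1) bounded_linear.has_derivative[OF assms(3) f(1)]])
       ((assumption | intro Suc.IH f)+)
qed

text \<open>In the chain rule \<open>g' (f x) (f' x v)\<close> the direction varies with
  \<open>x\<close>, while \<open>k_smooth\<close> speaks of fixed directions. Expanding
  \<open>f' x v\<close> in the basis of the middle space leaves products of a coefficient with
  \<open>g' (f x) b\<close> for fixed \<open>b\<close>, and the induction hypothesis applies to each
  map \<open>\<lambda>y. g' y b\<close>.\<close>

lemma k_smooth_compose:
  fixes f :: "'a::real_normed_vector \<Rightarrow> 'b::euclidean_space" and g :: "'b \<Rightarrow> 'c::real_normed_vector"
  assumes "open S" "open T" "f ` S \<subseteq> T" "k_smooth k S f" "k_smooth k T g"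
  shows "k_smooth k S (\<lambda>x. g (f x))"
  using assms(4,5)
proof (induction k arbitrary: g)
  case 0
  then show ?case using continuous_on_compose2[OF _ _ assms(3)] by auto
next
  case (Suc k)
  obtain f' where f: "\<And>x. x \<in> S \<Longrightarrow> (f has_derivative f' x) (at x)" "\<And>v. k_smooth k S (\<lambda>x. f' x v)"
    using k_smooth_Suc_derivative[OF Suc.prems(1)] by blast
  obtain g' where g: "\<And>x. x \<in> T \<Longrightarrow> (g has_derivative g' x) (at x)" "\<And>v. k_smooth k T (\<lambda>x. g' x v)"
    using k_smooth_Suc_derivative[OF Suc.prems(2)] by blast
  have fS: "f x \<in> T" if "x \<in> S" for x using that assms(3) by auto
  have k: "k_smooth k S f" using Suc.prems(1) by (rule k_smooth_SucD)
  have s: "k_smooth k S (\<lambda>x. \<Sum>b\<in>Basis. (f' x v \<bullet> b) *\<^sub>R g' (f x) b)" for v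
    by (intro k_smooth_sum k_smooth_scaleR assms(1) Suc.IH k g f
        k_smooth_bounded_linear[where h = "\<lambda>y. y \<bullet> _"] bounded_linear_inner_left)
  have d: "((\<lambda>x. g (f x)) has_derivative (\<lambda>v. \<Sum>b\<in>Basis. (f' x v \<bullet> b) *\<^sub>R g' (f x) b)) (at x)"
    if "x \<in> S" for x
  proof -
    have l: "linear (g' (f x))" using g(1)[OF fS[OF that]] has_derivative_linear by blast
    have "g' (f x) (f' x v) = (\<Sum>b\<in>Basis. (f' x v \<bullet> b) *\<^sub>R g' (f x) b)" for v
      by (subst euclidean_representation[symmetric, of "f' x v"])
         (simp add: linear_sum[OF l] linear_cmul[OF l])
    then show ?thesis
      using has_derivative_compose[OF f(1)[OF that] g(1)[OF fS[OF that]]] by simp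
  qed
  show ?case by (rule k_smooth_SucI[OF assms(1) d s])
qed

lemma smooth_on_compose:
  fixes f :: "'a::real_normed_vector \<Rightarrow> 'b::euclidean_space"
  assumes "open S" "open T" "f ` S \<subseteq> T" "smooth_on S f" "smooth_on T g"
  shows "smooth_on S (g \<circ> f)"
  using assms(4,5) k_smooth_compose[OF assms(1-3)]
  unfolding smooth_on_open_iff[OF assms(1)] smooth_on_open_iff[OF assms(2)] o_def by blast

subsection \<open>Local principal bundle isomorphisms\<close>

lemma invertible_mat_1 [simp]: "invertible (mat 1 :: real^'n^'n)"
  by (auto simp: invertible_def intro: exI[of _ "mat 1"])

lemma mem_frame_bundle: "X \<in> frame_bundle U \<longleftrightarrow> fst X \<in> U \<and> invertible (snd X)"
  using frame_bundle_iff[of "fst X" "snd X" U] by simp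

lemma frame_bundle_mono: "U \<subseteq> V \<Longrightarrow> frame_bundle U \<subseteq> frame_bundle V"
  by (auto simp: mem_frame_bundle)

lemma open_frame_bundle:
  fixes U :: "(real^'n) set"
  assumes "open U"
  shows "open (frame_bundle U)"
proof -
  have "frame_bundle U = U \<times> {Z. det Z \<noteq> 0}"
    by (auto simp: mem_frame_bundle invertible_det_nz)
  moreover have "open {Z :: real^'n^'n. det Z \<noteq> 0}"
    unfolding det_def by (intro open_Collect_neq continuous_intros)
  ultimately show ?thesis using assms by (simp add: open_Times)
qed

lemma frame_act_bundle: "X \<in> frame_bundle U \<Longrightarrow> invertible g \<Longrightarrow> frame_act X g \<in> frame_bundle U"
  by (simp add: mem_frame_bundle frame_act_def invertible_mult)

lemma fst_frame_act [simp]: "fst (frame_act X g) = fst X"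
  by (simp add: frame_act_def)

text \<open>Frames over a point are invertible matrices, so quotients of two of them lie in the
  group: with \<open>A\<close> and \<open>B\<close> the inverses of the two matrices,
  \<open>A ** snd Y\<close> and \<open>B ** snd X\<close> serve.\<close>

lemma frame_act_transitive:
  assumes "X \<in> frame_bundle U" "Y \<in> frame_bundle V" "fst X = fst Y"
  obtains g h where "invertible g" "invertible h" "frame_act X g = Y" "frame_act Y h = X"
proof -
  obtain A B where A: "snd X ** A = mat 1" "A ** snd X = mat 1"
    and B: "snd Y ** B = mat 1" "B ** snd Y = mat 1"
    using assms by (auto simp: mem_frame_bundle invertible_def)
  then have "invertible A" "invertible B" "invertible (snd X)" "invertible (snd Y)"
    unfolding invertible_def by auto
  then have "invertible (A ** snd Y)" "invertible (B ** snd X)"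
    by (simp_all add: invertible_mult)
  moreover have "frame_act X (A ** snd Y) = Y" "frame_act Y (B ** snd X) = X"
    using assms A B by (simp_all add: frame_act_def prod_eq_iff matrix_mul_assoc)
  ultimately show thesis using that by blast
qed

lemma bounded_linear_frame_act: "bounded_linear (\<lambda>X. frame_act X g)"
proof -
  have "linear (\<lambda>X. frame_act X g)"
    by (rule linearI)
      (auto simp: frame_act_def prod_eq_iff vec_eq_iff matrix_matrix_mult_def sum.distrib
        algebra_simps sum_distrib_left)
  then show ?thesis by (simp add: linear_conv_bounded_linear)
qed

lemma frame_lift_translation_eq: "frame_lift (translation v) X = (fst X + v, snd X)"
  using frame_lift_translation[of v "fst X" "snd X"] by simp

text \<open>An explicit two-sided inverse \<open>\<Phi>\<close> coincides with
  \<open>inv_into\<close> on the target and so supplies the smoothness of the inverse.\<close>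

lemma principal_isoI:
  assumes "open U" "open V"
    and "\<And>X. X \<in> frame_bundle U \<Longrightarrow> \<Psi> X \<in> frame_bundle V \<and> \<Phi> (\<Psi> X) = X"
    and "\<And>Y. Y \<in> frame_bundle V \<Longrightarrow> \<Phi> Y \<in> frame_bundle U \<and> \<Psi> (\<Phi> Y) = Y"
    and "smooth_on (frame_bundle U) \<Psi>" "smooth_on (frame_bundle V) \<Phi>"
    and "\<And>X g. X \<in> frame_bundle U \<Longrightarrow> invertible g \<Longrightarrow> \<Psi> (frame_act X g) = frame_act (\<Psi> X) g"
  shows "principal_iso U V \<Psi>"
proof -
  have bij: "bij_betw \<Psi> (frame_bundle U) (frame_bundle V)"
    by (rule bij_betw_byWitness[where f' = \<Phi>]) (use assms(3,4) in auto)
  have "inv_into (frame_bundle U) \<Psi> Y = \<Phi> Y" if "Y \<in> frame_bundle V" for Y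
    using bij_betw_imp_inj_on[OF bij] assms(4)[OF that] by (metis inv_into_f_eq)
  then have "smooth_on (frame_bundle V) (inv_into (frame_bundle U) \<Psi>)"
    using assms(6) by (simp cong: smooth_on_cong)
  with bij show ?thesis
    using assms by (auto simp: principal_iso_def diffeo_def)
qed

section \<open>Base maps and inverses of local isomorphisms\<close>

context
  fixes U V :: "(real^'n) set" and \<Psi> :: "'n::finite frame \<Rightarrow> 'n frame"
  assumes iso: "principal_iso U V \<Psi>"
begin

lemma principal_iso_open: "open U" "open V"
  using iso by (auto simp: principal_iso_def)

lemma principal_iso_smooth: "smooth_on (frame_bundle U) \<Psi>"
  "smooth_on (frame_bundle V) (inv_into (frame_bundle U) \<Psi>)"
  using iso by (auto simp: principal_iso_def diffeo_def)

lemma principal_iso_bij: "bij_betw \<Psi> (frame_bundle U) (frame_bundle V)"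
  using iso by (simp add: principal_iso_def diffeo_def)

lemma principal_iso_mem: "X \<in> frame_bundle U \<Longrightarrow> \<Psi> X \<in> frame_bundle V"
  using principal_iso_bij by (auto simp: bij_betw_def)

lemma principal_iso_act:
  "X \<in> frame_bundle U \<Longrightarrow> invertible g \<Longrightarrow> \<Psi> (frame_act X g) = frame_act (\<Psi> X) g"
  using iso by (simp add: principal_iso_def)

text \<open>Every frame is the identity frame over the same point, moved by the invertible matrix
  \<open>snd X\<close>, and the action fixes base points.\<close>

lemma fst_principal_iso:
  assumes "X \<in> frame_bundle U"
  shows "fst (\<Psi> X) = base_map \<Psi> (fst X)"
proof -
  have "(fst X, mat 1) \<in> frame_bundle U" "X = frame_act (fst X, mat 1) (snd X)" "invertible (snd X)"
    using assms by (auto simp: mem_frame_bundle frame_act_def)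
  then show ?thesis
    by (metis base_map_def fst_frame_act principal_iso_act)
qed

lemma base_map_mem: "x \<in> U \<Longrightarrow> base_map \<Psi> x \<in> V"
  using principal_iso_mem[of "(x, mat 1)"] by (simp add: mem_frame_bundle base_map_def)

lemma principal_iso_inv_into:
  "X \<in> frame_bundle U \<Longrightarrow> inv_into (frame_bundle U) \<Psi> (\<Psi> X) = X"
  "Y \<in> frame_bundle V \<Longrightarrow> \<Psi> (inv_into (frame_bundle U) \<Psi> Y) = Y"
  "Y \<in> frame_bundle V \<Longrightarrow> inv_into (frame_bundle U) \<Psi> Y \<in> frame_bundle U"
  using principal_iso_bij by (auto simp: bij_betw_inv_into_left bij_betw_inv_into_right
      intro: inv_into_into simp: bij_betw_def)

lemma principal_iso_inverse: "principal_iso V U (inv_into (frame_bundle U) \<Psi>)"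
proof (rule principal_isoI[where \<Phi> = \<Psi>])
  fix Y g assume Y: "Y \<in> frame_bundle V" and g: "invertible (g :: real^'n^'n)"
  let ?X = "inv_into (frame_bundle U) \<Psi> Y"
  have "frame_act Y g = \<Psi> (frame_act ?X g)"
    using Y g by (simp add: principal_iso_act principal_iso_inv_into)
  then show "inv_into (frame_bundle U) \<Psi> (frame_act Y g) = frame_act ?X g"
    using Y g by (simp add: principal_iso_inv_into frame_act_bundle)
qed (auto simp: principal_iso_open principal_iso_smooth principal_iso_inv_into principal_iso_mem)

lemma base_map_image: "base_map \<Psi> ` U = V"
proof (intro equalityI subsetI)
  fix y assume "y \<in> V"
  then have Y: "(y, mat 1) \<in> frame_bundle V" (is "?Y \<in> _")
    by (simp add: mem_frame_bundle)
  let ?X = "inv_into (frame_bundle U) \<Psi> ?Y"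
  have X: "?X \<in> frame_bundle U" "\<Psi> ?X = ?Y"
    using principal_iso_inv_into Y by auto
  then have "y = base_map \<Psi> (fst ?X)"
    using fst_principal_iso by (metis fst_conv)
  then show "y \<in> base_map \<Psi> ` U"
    using X by (auto simp: mem_frame_bundle)
qed (auto simp: base_map_mem)

lemma principal_iso_embedding: "principal_embedding U \<Psi>"
  using iso bij_betw_imp_surj_on[OF principal_iso_bij] frame_bundle_mono[of V UNIV]
  by (auto simp: principal_embedding_def smooth_embedding_def principal_iso_def)

end

lemma base_map_inverse:
  assumes "principal_iso U V \<Psi>" "x \<in> U"
  shows "base_map (inv_into (frame_bundle U) \<Psi>) (base_map \<Psi> x) = x"
proof -
  have x: "(x, mat 1) \<in> frame_bundle U" using assms(2) by (simp add: mem_frame_bundle)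
  show ?thesis
    using fst_principal_iso[OF principal_iso_inverse[OF assms(1)] principal_iso_mem[OF assms(1) x]]
    by (simp add: principal_iso_inv_into(1)[OF assms(1) x] base_map_def)
qed

text \<open>By equivariance and transitivity on fibres, the image consists of whole fibres, so it is
  the frame bundle over the image of the base map. Invariance of domain makes it open, and the
  projection to the base is an open map.\<close>

lemma principal_embedding_iso:
  fixes U :: "(real^'n) set"
  assumes "open U" "principal_embedding U \<kappa>"
  shows "principal_iso U (base_map \<kappa> ` U) \<kappa>"
proof -
  note k = assms(2)[unfolded principal_embedding_def smooth_embedding_def diffeo_def]
  have mem: "\<kappa> X \<in> frame_bundle UNIV" if "X \<in> frame_bundle U" for X
    using k that by blast
  have act: "\<kappa> (frame_act X g) = frame_act (\<kappa> X) g" if "X \<in> frame_bundle U" "invertible g" for X g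
    using k that by blast
  have one: "(x, mat 1) \<in> frame_bundle U" if "x \<in> U" for x
    using that by (simp add: mem_frame_bundle)
  have fst_k: "fst (\<kappa> X) = base_map \<kappa> (fst X)" if "X \<in> frame_bundle U" for X
  proof -
    have "(fst X, mat 1) \<in> frame_bundle U" "X = frame_act (fst X, mat 1) (snd X)" "invertible (snd X)"
      using that by (auto simp: mem_frame_bundle frame_act_def)
    then show ?thesis
      by (metis base_map_def fst_frame_act act)
  qed
  have im: "\<kappa> ` frame_bundle U = frame_bundle (base_map \<kappa> ` U)"
  proof (intro equalityI subsetI)
    fix Y assume "Y \<in> \<kappa> ` frame_bundle U"
    then show "Y \<in> frame_bundle (base_map \<kappa> ` U)"
      using mem fst_k by (auto simp: mem_frame_bundle)
  next
    fix Y assume Y: "Y \<in> frame_bundle (base_map \<kappa> ` U)"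
    then obtain x where x: "x \<in> U" "fst Y = base_map \<kappa> x"
      by (auto simp: mem_frame_bundle)
    then obtain g where "invertible g" "frame_act (\<kappa> (x, mat 1)) g = Y"
      using frame_act_transitive[OF mem[OF one] Y] by (metis base_map_def)
    then show "Y \<in> \<kappa> ` frame_bundle U"
      using act[OF one] frame_act_bundle[OF one] x by (metis imageI)
  qed
  have inj: "inj_on \<kappa> (frame_bundle U)" using k by (auto simp: bij_betw_def)
  have sm: "smooth_on (frame_bundle U) \<kappa>" using k by blast
  have "continuous_on (frame_bundle U) \<kappa>"
    using sm smooth_on_open_iff[OF open_frame_bundle[OF assms(1)]] k_smooth_continuous_on by blast
  then have "open (\<kappa> ` frame_bundle U)"
    using invariance_of_domain open_frame_bundle[OF assms(1)] inj by blast
  then have "open (fst ` \<kappa> ` frame_bundle U)" by (rule open_image_fst)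
  also have "fst ` \<kappa> ` frame_bundle U = base_map \<kappa> ` U"
  proof -
    have "fst ` \<kappa> ` frame_bundle U = base_map \<kappa> ` fst ` frame_bundle U"
      using fst_k by (simp add: image_image)
    also have "fst ` frame_bundle U = U"
    proof (intro equalityI subsetI)
      fix x assume "x \<in> U"
      then show "x \<in> fst ` frame_bundle U" using one[of x] by (metis fst_conv imageI)
    qed (auto simp: mem_frame_bundle)
    finally show ?thesis .
  qed
  finally show ?thesis
    using k assms(1) im act by (auto simp: principal_iso_def diffeo_def)
qed

section \<open>Restriction, composition and translations\<close>

lemma principal_iso_restrict:
  assumes "principal_iso U V \<Psi>" "open U'" "U' \<subseteq> U"
  shows "principal_iso U' (base_map \<Psi> ` U') \<Psi>"
proof (rule principal_embedding_iso[OF assms(2)])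
  note i = principal_iso_mem[OF assms(1)] principal_iso_act[OF assms(1)]
  have sub: "frame_bundle U' \<subseteq> frame_bundle U" using assms by (intro frame_bundle_mono)
  have inj: "inj_on \<Psi> (frame_bundle U)"
    using principal_iso_bij[OF assms(1)] by (auto simp: bij_betw_def)
  have inj': "inj_on \<Psi> (frame_bundle U')" using inj sub inj_on_subset by blast
  have im: "\<Psi> ` frame_bundle U' \<subseteq> frame_bundle V" using i(1) sub by blast
  \<comment> \<open>By injectivity the inverse of the restriction is a restriction of the inverse,
    so its smoothness is inherited.\<close>
  have "inv_into (frame_bundle U') \<Psi> Y = inv_into (frame_bundle U) \<Psi> Y"
    if "Y \<in> \<Psi> ` frame_bundle U'" for Y
    using that inj inj' sub by (auto simp: inv_into_f_f subset_eq)
  then have "smooth_on (\<Psi> ` frame_bundle U') (inv_into (frame_bundle U') \<Psi>)"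
    using smooth_on_subset[OF principal_iso_smooth(2)[OF assms(1)] im] by (simp cong: smooth_on_cong)
  moreover have "smooth_on (frame_bundle U') \<Psi>"
    using smooth_on_subset[OF principal_iso_smooth(1)[OF assms(1)] sub] .
  ultimately show "principal_embedding U' \<Psi>"
    using im sub i(2) inj' frame_bundle_mono[of V UNIV]
    by (auto simp: principal_embedding_def smooth_embedding_def diffeo_def bij_betw_def subset_eq)
qed

lemma principal_iso_compose:
  assumes "principal_iso U V \<Psi>" "principal_iso V W \<Phi>"
  shows "principal_iso U W (\<Phi> \<circ> \<Psi>)"
proof (rule principal_isoI[where \<Phi> = "inv_into (frame_bundle U) \<Psi> \<circ> inv_into (frame_bundle V) \<Phi>"])
  note a = principal_iso_mem[OF assms(1)] principal_iso_act[OF assms(1)] principal_iso_inv_into[OF assms(1)]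
  note b = principal_iso_mem[OF assms(2)] principal_iso_act[OF assms(2)] principal_iso_inv_into[OF assms(2)]
  note o = principal_iso_open[OF assms(1)] principal_iso_open[OF assms(2)]
  show "open U" "open W" using o by auto
  show "smooth_on (frame_bundle U) (\<Phi> \<circ> \<Psi>)"
    using a b o principal_iso_smooth[OF assms(1)] principal_iso_smooth[OF assms(2)]
    by (intro smooth_on_compose[of _ "frame_bundle V"]) (auto intro: open_frame_bundle)
  show "smooth_on (frame_bundle W) (inv_into (frame_bundle U) \<Psi> \<circ> inv_into (frame_bundle V) \<Phi>)"
    using a b o principal_iso_smooth[OF assms(1)] principal_iso_smooth[OF assms(2)]
    by (intro smooth_on_compose[of _ "frame_bundle V"]) (auto intro: open_frame_bundle)
qed (use assms in \<open>auto simp: principal_iso_mem principal_iso_act principal_iso_inv_into\<close>)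

lemma base_map_compose:
  assumes "principal_iso U V \<Psi>" "principal_iso V' W \<Phi>" "x \<in> U" "base_map \<Psi> x \<in> V'"
  shows "base_map (\<Phi> \<circ> \<Psi>) x = base_map \<Phi> (base_map \<Psi> x)"
proof -
  have "\<Psi> (x, mat 1) \<in> frame_bundle V"
    using assms by (intro principal_iso_mem[OF assms(1)]) (simp add: mem_frame_bundle)
  then have "\<Psi> (x, mat 1) \<in> frame_bundle V'"
    using assms(4) by (simp add: mem_frame_bundle base_map_def)
  then show ?thesis
    using fst_principal_iso[OF assms(2)] by (simp add: base_map_def)
qed

lemma principal_iso_continuous_base:
  assumes "principal_iso U V \<Psi>"
  shows "continuous_on U (base_map \<Psi>)"
proof -
  have "continuous_on (frame_bundle U) \<Psi>"
    using principal_iso_smooth(1)[OF assms] k_smooth_continuous_on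
      smooth_on_open_iff[OF open_frame_bundle[OF principal_iso_open(1)[OF assms]]] by blast
  then have "continuous_on U (\<lambda>x. fst (\<Psi> (x, mat 1)))"
    by (rule continuous_on_fst[OF continuous_on_compose2])
       (auto intro: continuous_intros simp: mem_frame_bundle)
  then show ?thesis by (simp add: base_map_def[abs_def])
qed

text \<open>The composite is controlled over \<open>D\<close>, where base points land in the domain
  of \<open>\<Phi>\<close>. Continuity of the base map makes \<open>D\<close> open, and both maps
  are cut down so that target and domain match.\<close>

lemma principal_iso_compose_restrict:
  assumes "principal_iso U V \<Psi>" "principal_iso V' W \<Phi>"
  defines "D \<equiv> {x \<in> U. base_map \<Psi> x \<in> V'}"
  shows "principal_iso D (base_map \<Phi> ` base_map \<Psi> ` D) (\<Phi> \<circ> \<Psi>)"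
proof -
  have "D = U \<inter> base_map \<Psi> -` V'" by (auto simp: D_def)
  then have "open D"
    using principal_iso_open[OF assms(1)] principal_iso_open[OF assms(2)]
      principal_iso_continuous_base[OF assms(1)] by (simp add: continuous_open_preimage)
  then have 1: "principal_iso D (base_map \<Psi> ` D) \<Psi>"
    by (intro principal_iso_restrict[OF assms(1)]) (auto simp: D_def)
  have "principal_iso (base_map \<Psi> ` D) (base_map \<Phi> ` base_map \<Psi> ` D) \<Phi>"
    using principal_iso_open[OF 1] by (intro principal_iso_restrict[OF assms(2)]) (auto simp: D_def)
  then show ?thesis using 1 principal_iso_compose by blast
qed

lemma principal_iso_translation:
  assumes "open U"
  shows "principal_iso U (translation v ` U) (frame_lift (translation v))"
proof -
  have sm: "smooth_on S (frame_lift (translation w))" if "open S" for S and w :: "real^'a"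
  proof -
    \<comment> \<open>The Jacobian of a translation is the identity, so its lift is again a
      translation, of the vector space that contains the frames.\<close>
    have "frame_lift (translation w) = (\<lambda>X. (w, 0) + X)"
      by (auto simp: frame_lift_translation_eq add.commute)
    then show ?thesis
      using k_smooth_affine[OF bounded_linear_ident, of _ S "(w, 0)"] that by (simp add: smooth_on_open_iff)
  qed
  have o: "open (translation v ` U)" using open_translation[OF assms, of v] by (simp add: add.commute)
  define w where "w = - v"
  have [simp]: "x + v + w = x" "x + w + v = x" for x by (auto simp: w_def)
  show ?thesis
    by (rule principal_isoI[where \<Phi> = "frame_lift (translation w)"])
      (auto simp: assms o sm open_frame_bundle frame_lift_translation_eq mem_frame_bundle frame_act_def)
qed

lemma base_map_translation: "base_map (frame_lift (translation v)) x = x + v"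
  by (simp add: base_map_def frame_lift_translation_eq)

subsection \<open>Jets and groupoids of jets\<close>

lemma principal_iso_has_derivative:
  assumes "principal_iso U V \<Psi>" "X \<in> frame_bundle U"
  shows "(\<Psi> has_derivative frechet_derivative \<Psi> (at X)) (at X)"
proof -
  have "k_smooth (Suc 0) (frame_bundle U) \<Psi>"
    using principal_iso_smooth(1)[OF assms(1)] principal_iso_open(1)[OF assms(1)]
    by (simp add: smooth_on_open_iff open_frame_bundle del: k_smooth.simps)
  then show ?thesis using assms(2) by (simp add: frechet_derivative_works)
qed

lemma jet1_cong_open:
  assumes "open N" "X \<in> N" "\<And>Y. Y \<in> N \<Longrightarrow> f Y = g Y"
  shows "jet1 f X = jet1 g X"
  using assms frechet_derivative_cong_open[OF assms] by (simp add: jet1_def)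

lemma jet1_compose:
  assumes "principal_iso U V \<Psi>" "principal_iso V' W \<Phi>" "X \<in> frame_bundle U" "\<Psi> X \<in> frame_bundle V'"
  shows "jet1 (\<Phi> \<circ> \<Psi>) X =
    (X, \<Phi> (\<Psi> X), frechet_derivative \<Phi> (at (\<Psi> X)) \<circ> frechet_derivative \<Psi> (at X))"
  using frechet_derivative_at[OF diff_chain_at[OF principal_iso_has_derivative[OF assms(1,3)]
    principal_iso_has_derivative[OF assms(2,4)]]]
  by (simp add: jet1_def)

text \<open>Both composites of \<open>\<Psi>\<close> with its inverse are the identity near the
  frame in question, so the chain rule yields a two-sided inverse of the derivative.\<close>

lemma bij_frechet_derivative:
  assumes "principal_iso U V \<Psi>" "X \<in> frame_bundle U"
  shows "bij (frechet_derivative \<Psi> (at X))"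
proof -
  let ?\<Phi> = "inv_into (frame_bundle U) \<Psi>"
  note inv = principal_iso_inverse[OF assms(1)] and Y = principal_iso_mem[OF assms]
  have o: "open (frame_bundle U)" "open (frame_bundle V)"
    using principal_iso_open[OF assms(1)] by (auto simp: open_frame_bundle)
  have "jet1 (?\<Phi> \<circ> \<Psi>) X = jet1 (\<lambda>x. x) X"
    by (rule jet1_cong_open[OF o(1) assms(2)]) (simp add: principal_iso_inv_into(1)[OF assms(1)])
  then have 1: "frechet_derivative ?\<Phi> (at (\<Psi> X)) \<circ> frechet_derivative \<Psi> (at X) = id"
    using jet1_compose[OF assms(1) inv assms(2) Y]
    by (simp add: jet1_def[of "\<lambda>x. x"] id_def)
  have "jet1 (\<Psi> \<circ> ?\<Phi>) (\<Psi> X) = jet1 (\<lambda>x. x) (\<Psi> X)"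
    by (rule jet1_cong_open[OF o(2) Y]) (simp add: principal_iso_inv_into(2)[OF assms(1)])
  then have "frechet_derivative \<Psi> (at X) \<circ> frechet_derivative ?\<Phi> (at (\<Psi> X)) = id"
    using jet1_compose[OF inv assms(1) Y] assms(2) principal_iso_inv_into(1)[OF assms]
    by (simp add: jet1_def[of "\<lambda>x. x"] id_def)
  with 1 show ?thesis by (rule o_bij)
qed

text \<open>Since \<open>h\<close> is inverse to \<open>g\<close>, equivariance writes
  \<open>\<Psi>\<close> as the action of \<open>h\<close>, then \<open>\<Psi>\<close>, then the
  action of \<open>g\<close>. These actions are linear in the frame, so the chain rule transports
  the derivative along the fibre.\<close>

lemma frechet_derivative_frame_act:
  assumes "principal_iso U V \<Psi>" "X \<in> frame_bundle U" "invertible g" "invertible h"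
    "frame_act (frame_act X g) h = X"
  shows "frechet_derivative \<Psi> (at (frame_act X g)) =
    (\<lambda>Y. frame_act Y g) \<circ> frechet_derivative \<Psi> (at X) \<circ> (\<lambda>Y. frame_act Y h)"
proof -
  let ?X = "frame_act X g"
  have X': "?X \<in> frame_bundle U" by (rule frame_act_bundle[OF assms(2,3)])
  \<comment> \<open>The invertible matrix \<open>snd X\<close> cancels from the relation between
    \<open>g\<close> and \<open>h\<close>, and a one-sided inverse of a square matrix is
    two-sided.\<close>
  have hg: "h ** g = mat 1"
  proof -
    obtain A where A: "snd X ** A = mat 1" "A ** snd X = mat 1"
      using assms(2) by (auto simp: mem_frame_bundle invertible_def)
    have "snd X ** (g ** h) = snd X"
      using assms(5) by (auto simp: frame_act_def prod_eq_iff matrix_mul_assoc)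
    then have "g ** h = mat 1" by (metis A(2) matrix_mul_assoc matrix_mul_lid)
    then show ?thesis by (simp add: matrix_left_right_inverse)
  qed
  have act: "((\<lambda>Y. frame_act Y k) has_derivative (\<lambda>Y. frame_act Y k)) (at Y)" for k :: "real^'a^'a" and Y
    by (rule bounded_linear_imp_has_derivative[OF bounded_linear_frame_act])
  have d: "((\<lambda>Y. frame_act Y g) \<circ> (\<Psi> \<circ> (\<lambda>Y. frame_act Y h)) has_derivative
      (\<lambda>Y. frame_act Y g) \<circ> (frechet_derivative \<Psi> (at X) \<circ> (\<lambda>Y. frame_act Y h))) (at ?X)"
    using principal_iso_has_derivative[OF assms(1,2)] assms(5) by (intro diff_chain_at act) simp
  have e: "frame_act (\<Psi> (frame_act Y h)) g = \<Psi> Y" if "Y \<in> frame_bundle U" for Y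
    using principal_iso_act[OF assms(1) frame_act_bundle[OF that assms(4)] assms(3)] hg
    by (simp add: frame_act_def flip: matrix_mul_assoc)
  have "(\<Psi> has_derivative
      (\<lambda>Y. frame_act Y g) \<circ> (frechet_derivative \<Psi> (at X) \<circ> (\<lambda>Y. frame_act Y h))) (at ?X)"
    by (rule has_derivative_transform_within_open
        [OF d open_frame_bundle[OF principal_iso_open(1)[OF assms(1)]] X']) (simp only: o_apply e)
  from frechet_derivative_at[OF this] show ?thesis by (simp only: comp_assoc)
qed

text \<open>One jet determines its class: every other frame over the same point is
  \<open>frame_act X g\<close>, and equivariance computes value and derivative there from those at
  \<open>X\<close>.\<close>

lemma jet_class_eqI:
  assumes "principal_iso U V \<Psi>" "principal_iso U' V' \<Phi>"
    and "X \<in> frame_bundle U" "X \<in> frame_bundle U'" "jet1 \<Psi> X = jet1 \<Phi> X"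
  shows "jet_class \<Psi> (fst X) = jet_class \<Phi> (fst X)"
  unfolding jet_class_def
proof (rule image_cong)
  fix Y assume Y: "Y \<in> frame_bundle {fst X}"
  then have "fst X = fst Y" by (simp add: mem_frame_bundle)
  then obtain g h where g: "invertible g" "invertible h" "frame_act X g = Y" "frame_act Y h = X"
    by (rule frame_act_transitive[OF assms(3) Y])
  then have h: "frame_act (frame_act X g) h = X" by simp
  note d = frechet_derivative_frame_act[OF assms(1,3) g(1,2) h]
    frechet_derivative_frame_act[OF assms(2,4) g(1,2) h]
  note a = principal_iso_act[OF assms(1,3) g(1)] principal_iso_act[OF assms(2,4) g(1)]
  show "jet1 \<Psi> Y = jet1 \<Phi> Y"
    using assms(5) unfolding jet1_def g(3)[symmetric] d a by simp
qed simp

section \<open>Representatives, sources and targets in the groupoid of jets\<close>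

lemma jet_groupoidE:
  assumes "L \<in> jet_groupoid B" "(X, Y, D) \<in> L"
  obtains \<Psi> U V where "principal_iso U V \<Psi>" "U \<subseteq> B" "V \<subseteq> B" "X \<in> frame_bundle U"
    "L = jet_class \<Psi> (fst X)" "Y = \<Psi> X" "D = frechet_derivative \<Psi> (at X)"
proof -
  obtain \<Psi> U V x where *: "L = jet_class \<Psi> x" "principal_iso U V \<Psi>" "U \<subseteq> B" "V \<subseteq> B" "x \<in> U"
    using assms(1) unfolding jet_groupoid_def by blast
  then obtain X' where X': "X' \<in> frame_bundle {x}" "(X, Y, D) = jet1 \<Psi> X'"
    using assms(2) by (auto simp: jet_class_def)
  then have "X = X'" by (simp add: jet1_def)
  with X' * show thesis
    by (intro that[of U V \<Psi>]) (auto simp: jet1_def mem_frame_bundle)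
qed

text \<open>\<open>the_elem\<close> is meaningful here because all source frames of a class lie over
  one point, and so do their images by \<open>fst_principal_iso\<close>.\<close>

lemma jet_source_target:
  assumes "L \<in> jet_groupoid B" "(X, Y, D) \<in> L"
  shows "jet_source L = fst X" "jet_target L = fst Y"
proof -
  obtain \<Psi> U V where *: "principal_iso U V \<Psi>" "X \<in> frame_bundle U"
    "L = jet_class \<Psi> (fst X)" "Y = \<Psi> X"
    using assms by (rule jet_groupoidE)
  have X: "X \<in> frame_bundle {fst X}" using *(2) by (simp add: mem_frame_bundle)
  have "(\<lambda>(X, Y, D). fst X) ` L = {fst X}"
    using X unfolding *(3) jet_class_def image_image jet1_def by (auto simp: mem_frame_bundle)
  then show "jet_source L = fst X" by (simp add: jet_source_def)
  have "fst (\<Psi> X') = base_map \<Psi> (fst X)" if "X' \<in> frame_bundle {fst X}" for X'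
    using that *(2) fst_principal_iso[OF *(1), of X'] by (auto simp: mem_frame_bundle)
  then have "(\<lambda>(X, Y, D). fst Y) ` L = {base_map \<Psi> (fst X)}"
    using X unfolding *(3) jet_class_def image_image jet1_def by (auto intro!: image_eqI[of _ _ X])
  then show "jet_target L = fst Y"
    using fst_principal_iso[OF *(1,2)] by (simp add: jet_target_def *(4))
qed

section \<open>Individual jets in a wide subgroupoid\<close>

context
  fixes B :: "(real^'n::finite) set" and \<Omega> :: "'n jet set set"
  assumes wide: "wide_subgroupoid B \<Omega>"
begin

lemma mem_jet_groupoid: "L \<in> \<Omega> \<Longrightarrow> L \<in> jet_groupoid B"
  using wide unfolding wide_subgroupoid_def by blast

text \<open>Passing to \<open>\<Union>\<Omega>\<close> turns the operations on classes into
  operations on single triples, which suit computations with derivatives.\<close>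

lemma jets_inverse:
  assumes "(X, Y, D) \<in> \<Union>\<Omega>"
  shows "(Y, X, inv D) \<in> \<Union>\<Omega>"
proof -
  obtain L where L: "L \<in> \<Omega>" "(X, Y, D) \<in> L" using assms by blast
  then have "(Y, X, inv D) \<in> jet_inv L" unfolding jet_inv_def by blast
  moreover have "jet_inv L \<in> \<Omega>" using L(1) wide by (simp add: wide_subgroupoid_def)
  ultimately show ?thesis by blast
qed

text \<open>The common frame \<open>Y\<close> makes the target of one class the source of the other
  and matches the two representatives in \<open>jet_comp\<close>.\<close>

lemma jets_compose:
  assumes "(X, Y, D) \<in> \<Union>\<Omega>" "(Y, Z, D') \<in> \<Union>\<Omega>"
  shows "(X, Z, D' \<circ> D) \<in> \<Union>\<Omega>"
proof -
  obtain L M where L: "L \<in> \<Omega>" "(X, Y, D) \<in> L" and M: "M \<in> \<Omega>" "(Y, Z, D') \<in> M"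
    using assms by blast
  then have "jet_source M = jet_target L"
    using jet_source_target(2)[OF mem_jet_groupoid L(2)] jet_source_target(1)[OF mem_jet_groupoid M(2)]
    by simp
  then have "jet_comp M L \<in> \<Omega>" using L M wide by (simp add: wide_subgroupoid_def)
  moreover have "(X, Z, D' \<circ> D) \<in> jet_comp M L" using L M unfolding jet_comp_def by blast
  ultimately show ?thesis by blast
qed

lemma jets_bij:
  assumes "(X, Y, D) \<in> \<Union>\<Omega>"
  shows "bij D"
proof -
  obtain L where L: "L \<in> \<Omega>" "(X, Y, D) \<in> L" using assms by blast
  show ?thesis
    by (rule jet_groupoidE[OF mem_jet_groupoid[OF L(1)] L(2)]) (simp add: bij_frechet_derivative)
qed

text \<open>The way back from triples to classes: \<open>\<Psi>\<close> shares a jet with some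
  element of \<open>\<Omega>\<close>, and a shared jet makes the classes equal.\<close>

lemma jet_class_mem:
  assumes "principal_iso U V \<Psi>" "X \<in> frame_bundle U" "jet1 \<Psi> X \<in> \<Union>\<Omega>"
  shows "jet_class \<Psi> (fst X) \<in> \<Omega>"
proof -
  obtain L where L: "L \<in> \<Omega>" "(X, \<Psi> X, frechet_derivative \<Psi> (at X)) \<in> L"
    using assms(3) by (auto simp: jet1_def)
  then obtain \<Phi> U' V' where *: "principal_iso U' V' \<Phi>" "X \<in> frame_bundle U'"
    "L = jet_class \<Phi> (fst X)" "\<Psi> X = \<Phi> X"
    "frechet_derivative \<Psi> (at X) = frechet_derivative \<Phi> (at X)"
    by (rule jet_groupoidE[OF mem_jet_groupoid]) blast
  then have "jet1 \<Psi> X = jet1 \<Phi> X" by (simp add: jet1_def)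
  then show ?thesis using jet_class_eqI[OF assms(1) *(1) assms(2) *(2)] L *(3) by simp
qed

end

text \<open>A material class containing a jet that starts at the frame \<open>Y\<close> has source
  \<open>fst Y\<close>, so the orbit of the crystal can be described by single material
  jets.\<close>

lemma crystal_structure_iff:
  assumes "wide_subgroupoid B (material_groupoid B W)"
  shows "P \<in> crystal_structure B W (E, Y, D\<^sub>0) \<longleftrightarrow>
    (\<exists>X D. P = (E, X, D \<circ> D\<^sub>0) \<and> (Y, X, D) \<in> \<Union>(material_groupoid B W))"
proof -
  have "jet_source L = fst Y" if "L \<in> material_groupoid B W" "(Y, X, D) \<in> L" for L X D
    using jet_source_target(1)[OF mem_jet_groupoid[OF assms that(1)] that(2)] .
  then have src: "{L \<in> material_groupoid B W. jet_source L = fst Y \<and> (Y, X, D) \<in> L} =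
      {L \<in> material_groupoid B W. (Y, X, D) \<in> L}" for X D
    by blast
  have comp: "P \<in> jet_comp L {(E, Y, D\<^sub>0)} \<longleftrightarrow> (\<exists>X D. P = (E, X, D \<circ> D\<^sub>0) \<and> (Y, X, D) \<in> L)" for L
    unfolding jet_comp_def by blast
  have "P \<in> crystal_structure B W (E, Y, D\<^sub>0) \<longleftrightarrow>
      (\<exists>L X D. P = (E, X, D \<circ> D\<^sub>0) \<and>
        L \<in> {L \<in> material_groupoid B W. jet_source L = fst Y \<and> (Y, X, D) \<in> L})"
    unfolding crystal_structure_def UN_iff comp second_frame_base_def by auto
  then show ?thesis unfolding src by blast
qed

subsection \<open>Homogeneity and reference crystals\<close>

lemma e1_mem: "0 \<in> N \<Longrightarrow> e1 \<in> frame_bundle N"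
  by (simp add: e1_eq mem_frame_bundle)

text \<open>Surjectivity cancels \<open>D\<^sub>0\<close> on the right, and \<open>D\<close> is
  inverted. This solves for the derivative of a shift once the derivatives of two frame maps are
  known.\<close>

lemma comp_eq_compI: "bij D \<Longrightarrow> surj D\<^sub>0 \<Longrightarrow> E \<circ> (D \<circ> D\<^sub>0) = D' \<circ> D\<^sub>0 \<Longrightarrow> E = D' \<circ> inv D"
  by (metis bij_betw_def comp_assoc comp_id fun.map_comp surj_iff)

text \<open>Seen through \<open>\<kappa>\<close> this is the translation by \<open>v\<close>. With
  \<open>v\<close> the difference of the images of \<open>y\<close> and \<open>x\<close>, it is the
  map whose jet at \<open>x\<close> homogeneity requires to be material.\<close>

abbreviation material_shift ::
    "(real^'n) set \<Rightarrow> ('n::finite frame \<Rightarrow> 'n frame) \<Rightarrow> real^'n \<Rightarrow> 'n frame \<Rightarrow> 'n frame" where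
  "material_shift U \<kappa> v \<equiv> inv_into (frame_bundle U) \<kappa> \<circ> frame_lift (translation v) \<circ> \<kappa>"

text \<open>The map \<open>f\<^sub>x\<close> of the introduction; its jet at \<open>e1\<close> is
  the value at \<open>x\<close> of the field of second-order frames induced by
  \<open>\<kappa>\<close>.\<close>

abbreviation material_frame ::
    "(real^'n) set \<Rightarrow> ('n::finite frame \<Rightarrow> 'n frame) \<Rightarrow> real^'n \<Rightarrow> 'n frame \<Rightarrow> 'n frame" where
  "material_frame U \<kappa> x \<equiv> inv_into (frame_bundle U) \<kappa> \<circ> frame_lift (translation (base_map \<kappa> x))"

context
  fixes U V :: "(real^'n::finite) set" and \<kappa>
  assumes iso: "principal_iso U V \<kappa>"
begin

text \<open>On \<open>D v\<close> the translated point stays in the image of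
  \<open>\<kappa>\<close>, where the inverse may be applied. The last conclusion lets one and the
  same shift act as the shift from every point of \<open>D v\<close> to its image.\<close>

lemma principal_iso_material_shift:
  defines "D v \<equiv> {x \<in> U. base_map \<kappa> x + v \<in> V}"
  obtains V' where "principal_iso (D v) V' (material_shift U \<kappa> v)" "V' \<subseteq> U"
    "\<forall>x\<in>D v. base_map \<kappa> (base_map (material_shift U \<kappa> v) x) = base_map \<kappa> x + v"
proof -
  let ?inv = "inv_into (frame_bundle U) \<kappa>"
  let ?T = "frame_lift (translation v) :: 'n frame \<Rightarrow> 'n frame"
  note inv = principal_iso_inverse[OF iso]
  note t = principal_iso_translation[OF principal_iso_open(2)[OF iso], of v]
  have c: "principal_iso U (translation v ` V) (?T \<circ> \<kappa>)"
    by (rule principal_iso_compose[OF iso t])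
  have b: "base_map (?T \<circ> \<kappa>) x = base_map \<kappa> x + v" if "x \<in> U" for x
    using base_map_compose[OF iso t that base_map_mem[OF iso that]] by (simp add: base_map_translation)
  have D: "D v = {x \<in> U. base_map (?T \<circ> \<kappa>) x \<in> V}" using b by (auto simp: D_def)
  let ?V' = "base_map ?inv ` base_map (?T \<circ> \<kappa>) ` D v"
  have i: "principal_iso (D v) ?V' (material_shift U \<kappa> v)"
    using principal_iso_compose_restrict[OF c inv] unfolding D by (simp only: comp_assoc)
  have s: "?V' \<subseteq> U" using base_map_mem[OF inv] by (auto simp: D)
  have "base_map \<kappa> (base_map (material_shift U \<kappa> v) x) = base_map \<kappa> x + v"
    if "x \<in> D v" for x
  proof -
    have x: "x \<in> U" "base_map \<kappa> x + v \<in> V" using that by (auto simp: D_def)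
    then obtain x' where x': "x' \<in> U" "base_map \<kappa> x + v = base_map \<kappa> x'"
      using base_map_image[OF iso] by auto
    have "base_map (material_shift U \<kappa> v) x = base_map ?inv (base_map (?T \<circ> \<kappa>) x)"
      using base_map_compose[OF c inv x(1)] x b[OF x(1)] by (simp add: comp_assoc)
    also have "\<dots> = x'" using b[OF x(1)] x' base_map_inverse[OF iso] by simp
    finally show ?thesis using x' by simp
  qed
  then have "\<forall>x\<in>D v. base_map \<kappa> (base_map (material_shift U \<kappa> v) x) = base_map \<kappa> x + v"
    by blast
  with i s show thesis by (rule that)
qed

lemma principal_iso_material_frame:
  assumes "x \<in> U"
  obtains N where "0 \<in> N" "principal_iso N U (material_frame U \<kappa> x)"
proof -
  let ?c = "base_map \<kappa> x"
  \<comment> \<open>Moving the image of \<open>x\<close> to the origin puts \<open>e1\<close> into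
    the domain.\<close>
  let ?N = "translation (- ?c) ` V"
  have "open ?N"
    using open_translation[OF principal_iso_open(2)[OF iso], of "- ?c"] by (simp add: add.commute)
  moreover have "translation ?c ` ?N = V" by (simp add: image_image)
  ultimately have "principal_iso ?N V (frame_lift (translation ?c))"
    using principal_iso_translation[of ?N ?c] by simp
  from principal_iso_compose[OF this principal_iso_inverse[OF iso]]
  have i: "principal_iso ?N U (material_frame U \<kappa> x)" .
  have "0 \<in> ?N" using base_map_mem[OF iso assms] by (intro image_eqI[of _ _ ?c]) simp_all
  then show thesis using i by (rule that)
qed

lemma material_frame_e1:
  assumes "x \<in> U"
  shows "material_frame U \<kappa> x e1 \<in> frame_bundle {x}"
proof -
  have y: "(base_map \<kappa> x, mat 1) \<in> frame_bundle V" (is "?Y \<in> _")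
    using base_map_mem[OF iso assms] by (simp add: mem_frame_bundle)
  have "fst (inv_into (frame_bundle U) \<kappa> ?Y) = x"
    using fst_principal_iso[OF principal_iso_inverse[OF iso] y] base_map_inverse[OF iso assms] by simp
  then show ?thesis
    using principal_iso_inv_into(3)[OF iso y]
    by (simp add: mem_frame_bundle frame_lift_translation_eq e1_eq)
qed

text \<open>In shift after \<open>f\<^sub>x\<close>, \<open>\<kappa>\<close> cancels its inverse and
  the translations add up to the one in \<open>f\<^sub>y\<close>. The conclusions are the value and
  derivative parts of this equality of jets at \<open>e1\<close>.\<close>

lemma material_shift_frame:
  assumes "x \<in> U" "y \<in> U"
  defines "X \<equiv> material_frame U \<kappa> x e1" and "\<Psi> \<equiv> material_shift U \<kappa> (base_map \<kappa> y - base_map \<kappa> x)"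
  shows "\<Psi> X = material_frame U \<kappa> y e1"
    and "frechet_derivative \<Psi> (at X) \<circ> frechet_derivative (material_frame U \<kappa> x) (at e1) =
      frechet_derivative (material_frame U \<kappa> y) (at e1)"
proof -
  let ?v = "base_map \<kappa> y - base_map \<kappa> x"
  let ?D = "{x \<in> U. base_map \<kappa> x + ?v \<in> V}"
  obtain V' where s: "principal_iso ?D V' \<Psi>"
    unfolding \<Psi>_def by (rule principal_iso_material_shift)
  obtain N where N: "0 \<in> N" "principal_iso N U (material_frame U \<kappa> x)"
    using assms(1) by (rule principal_iso_material_frame)
  have X: "X \<in> frame_bundle {x}" using material_frame_e1[OF assms(1)] by (simp add: X_def)
  have xD: "x \<in> ?D" using assms(1,2) base_map_mem[OF iso] by simp
  with X have XD: "X \<in> frame_bundle ?D" by (simp add: mem_frame_bundle)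
  \<comment> \<open>The frames whose translates lie over \<open>V\<close>, where
    \<open>\<kappa>\<close> undoes its inverse; they form an open neighbourhood of
    \<open>e1\<close>.\<close>
  let ?N = "frame_bundle {w. w + base_map \<kappa> x \<in> V}"
  have "continuous_on UNIV (translation (base_map \<kappa> x))" by (intro continuous_intros)
  from open_vimage[OF principal_iso_open(2)[OF iso] this]
  have "open {w. w + base_map \<kappa> x \<in> V}" by (simp add: vimage_def)
  then have o: "open ?N" by (rule open_frame_bundle)
  have e: "e1 \<in> ?N" using base_map_mem[OF iso assms(1)] by (intro e1_mem) simp
  have "jet1 (\<Psi> \<circ> material_frame U \<kappa> x) e1 = jet1 (material_frame U \<kappa> y) e1"
  proof (rule jet1_cong_open[OF o e])
    fix Y assume "Y \<in> ?N"
    then have "(fst Y + base_map \<kappa> x, snd Y) \<in> frame_bundle V" by (simp add: mem_frame_bundle)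
    then show "(\<Psi> \<circ> material_frame U \<kappa> x) Y = material_frame U \<kappa> y Y"
      by (simp add: \<Psi>_def frame_lift_translation_eq principal_iso_inv_into(2)[OF iso])
  qed
  note eq = this[unfolded jet1_compose[OF N(2) s e1_mem[OF N(1)] XD[unfolded X_def]]]
  show "\<Psi> X = material_frame U \<kappa> y e1"
    and "frechet_derivative \<Psi> (at X) \<circ> frechet_derivative (material_frame U \<kappa> x) (at e1) =
      frechet_derivative (material_frame U \<kappa> y) (at e1)"
    using eq by (simp_all only: jet1_def prod.inject X_def)
qed

end

section \<open>Passage between homogeneity and a reference crystal\<close>

lemma homogeneous_imp_wrt:
  fixes B :: "(real^'n::finite) set"
  assumes wide: "wide_subgroupoid B (material_groupoid B W)"
    and U: "open U" "U \<subseteq> B" "homogeneous_on B W U" "z \<in> U"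
  obtains Z\<^sub>0 where "Z\<^sub>0 \<in> second_frame_bundle B" "homogeneous_wrt_on B W Z\<^sub>0 U"
proof -
  obtain \<kappa> where \<kappa>: "deformation U \<kappa>" and hom: "\<And>x y. x \<in> U \<Longrightarrow> y \<in> U \<Longrightarrow>
      jet_class (material_shift U \<kappa> (base_map \<kappa> y - base_map \<kappa> x)) x \<in> material_groupoid B W"
    using U(3) unfolding homogeneous_on_def by blast
  obtain V where iso: "principal_iso U V \<kappa>"
    using principal_embedding_iso U(1) \<kappa> unfolding deformation_def by blast
  \<comment> \<open>The crystal is the jet that \<open>\<kappa>\<close> itself induces at
    \<open>z\<close>; the shifts from \<open>z\<close> carry it to the frames induced at all other
    points.\<close>
  define X\<^sub>0 where "X\<^sub>0 = material_frame U \<kappa> z e1"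
  define D\<^sub>0 where "D\<^sub>0 = frechet_derivative (material_frame U \<kappa> z) (at e1)"
  obtain N where N: "0 \<in> N" "principal_iso N U (material_frame U \<kappa> z)"
    using principal_iso_material_frame[OF iso U(4)] .
  have "jet1 (material_frame U \<kappa> z) e1 \<in> second_frame_bundle B"
    unfolding second_frame_bundle_def mem_Collect_eq
    by (intro exI conjI) (rule refl N U(2))+
  then have Z: "(e1, X\<^sub>0, D\<^sub>0) \<in> second_frame_bundle B" by (simp add: jet1_def X\<^sub>0_def D\<^sub>0_def)
  have "jet1 (material_frame U \<kappa> x) e1 \<in> crystal_structure B W (e1, X\<^sub>0, D\<^sub>0)" if "x \<in> U" for x
  proof -
    let ?\<Psi> = "material_shift U \<kappa> (base_map \<kappa> x - base_map \<kappa> z)"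
    note s = material_shift_frame[OF iso U(4) that, folded X\<^sub>0_def D\<^sub>0_def]
    have X0: "X\<^sub>0 \<in> frame_bundle {z}" using material_frame_e1[OF iso U(4)] by (simp add: X\<^sub>0_def)
    then have "jet1 ?\<Psi> X\<^sub>0 \<in> \<Union>(material_groupoid B W)"
      using hom[OF U(4) that] by (auto simp: jet_class_def)
    then have "(X\<^sub>0, material_frame U \<kappa> x e1, frechet_derivative ?\<Psi> (at X\<^sub>0)) \<in> \<Union>(material_groupoid B W)"
      unfolding jet1_def s(1) .
    then show ?thesis
      unfolding crystal_structure_iff[OF wide] jet1_def using s(2)[symmetric] by blast
  qed
  then have "homogeneous_wrt_on B W (e1, X\<^sub>0, D\<^sub>0) U"
    unfolding homogeneous_wrt_on_def using \<kappa> by blast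
  with Z that show thesis by blast
qed

lemma second_frame_bundleE:
  assumes "Z \<in> second_frame_bundle B"
  obtains Y D where "Z = (e1, Y, D)" "bij D"
proof -
  obtain \<Psi> U V where *: "Z = jet1 \<Psi> e1" "principal_iso U V \<Psi>" "0 \<in> U"
    using assms unfolding second_frame_bundle_def by blast
  then show thesis
    using that bij_frechet_derivative[OF *(2) e1_mem] by (auto simp: jet1_def)
qed

text \<open>Each \<open>f\<^sub>x\<close> has derivative \<open>D x \<circ> D\<^sub>0\<close> with
  \<open>D x\<close> from a material jet. Since the shift carries \<open>f\<^sub>x\<close> to
  \<open>f\<^sub>y\<close>, cancelling \<open>D\<^sub>0\<close> gives it the derivative
  \<open>D y \<circ> inv (D x)\<close>, a composite of material jets.\<close>

lemma wrt_imp_homogeneous: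
  fixes B :: "(real^'n::finite) set"
  assumes wide: "wide_subgroupoid B (material_groupoid B W)"
    and U: "open U" and Z: "Z\<^sub>0 \<in> second_frame_bundle B" and wrt: "homogeneous_wrt_on B W Z\<^sub>0 U"
  shows "homogeneous_on B W U"
proof -
  obtain \<kappa> where \<kappa>: "deformation U \<kappa>" and hom: "\<And>x. x \<in> U \<Longrightarrow>
      jet1 (material_frame U \<kappa> x) e1 \<in> crystal_structure B W Z\<^sub>0"
    using wrt unfolding homogeneous_wrt_on_def by blast
  obtain V where iso: "principal_iso U V \<kappa>"
    using principal_embedding_iso U \<kappa> unfolding deformation_def by blast
  obtain Y\<^sub>0 D\<^sub>0 where Z0: "Z\<^sub>0 = (e1, Y\<^sub>0, D\<^sub>0)" "bij D\<^sub>0" using Z by (rule second_frame_bundleE)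
  let ?J = "\<Union>(material_groupoid B W)"
  have "\<exists>D. frechet_derivative (material_frame U \<kappa> x) (at e1) = D \<circ> D\<^sub>0 \<and>
      (Y\<^sub>0, material_frame U \<kappa> x e1, D) \<in> ?J" if "x \<in> U" for x
    using hom[OF that] unfolding Z0(1) crystal_structure_iff[OF wide] jet1_def by blast
  then obtain D where D: "\<And>x. x \<in> U \<Longrightarrow> frechet_derivative (material_frame U \<kappa> x) (at e1) = D x \<circ> D\<^sub>0"
    "\<And>x. x \<in> U \<Longrightarrow> (Y\<^sub>0, material_frame U \<kappa> x e1, D x) \<in> ?J"
    by metis
  have "jet_class (material_shift U \<kappa> (base_map \<kappa> y - base_map \<kappa> x)) x \<in> material_groupoid B W"
    if x: "x \<in> U" and y: "y \<in> U" for x y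
  proof -
    let ?v = "base_map \<kappa> y - base_map \<kappa> x"
    let ?\<Psi> = "material_shift U \<kappa> ?v" and ?X = "material_frame U \<kappa> x e1"
    note s = material_shift_frame[OF iso x y]
    have X: "?X \<in> frame_bundle {x}" by (rule material_frame_e1[OF iso x])
    have "frechet_derivative ?\<Psi> (at ?X) = D y \<circ> inv (D x)"
      using s(2) D(1)[OF x] D(1)[OF y]
      by (intro comp_eq_compI[OF jets_bij[OF wide D(2)[OF x]] bij_is_surj[OF Z0(2)]]) metis
    then have "jet1 ?\<Psi> ?X = (?X, material_frame U \<kappa> y e1, D y \<circ> inv (D x))"
      unfolding jet1_def s(1) by simp
    then have J: "jet1 ?\<Psi> ?X \<in> ?J"
      using jets_compose[OF wide jets_inverse[OF wide D(2)[OF x]] D(2)[OF y]] by metis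
    obtain V' where iso': "principal_iso {x \<in> U. base_map \<kappa> x + ?v \<in> V} V' ?\<Psi>"
      by (rule principal_iso_material_shift[OF iso])
    have "?X \<in> frame_bundle {x \<in> U. base_map \<kappa> x + ?v \<in> V}" "fst ?X = x"
      using X x base_map_mem[OF iso y] unfolding mem_frame_bundle by simp_all
    then show ?thesis
      using jet_class_mem[OF wide iso' _ J] by metis
  qed
  then show ?thesis unfolding homogeneous_on_def using \<kappa> by blast
qed

section \<open>Spreading one crystal over a connected body\<close>

text \<open>The new deformation \<open>\<mu>\<close> undoes the shift \<open>\<Psi>\<close> and then
  applies \<open>\<kappa>'\<close>. Its frame map at the image of \<open>u\<close> is
  \<open>\<Psi>\<close> after the frame map of \<open>\<kappa>'\<close> at \<open>u\<close>, so
  composing with the material jet of \<open>\<Psi>\<close> stays in the orbit of the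
  crystal.\<close>

lemma homogeneous_wrt_transport:
  fixes B :: "(real^'n::finite) set"
  assumes wide: "wide_subgroupoid B (material_groupoid B W)"
    and Z: "Z\<^sub>0 \<in> second_frame_bundle B"
    and U: "open U" "homogeneous_on B W U" "x \<in> U" "y \<in> U"
    and U': "open U'" "homogeneous_wrt_on B W Z\<^sub>0 U'" "x \<in> U'"
  obtains E where "open E" "y \<in> E" "E \<subseteq> U" "homogeneous_wrt_on B W Z\<^sub>0 E"
proof -
  obtain \<kappa> where \<kappa>: "deformation U \<kappa>" and hom: "\<And>x y. x \<in> U \<Longrightarrow> y \<in> U \<Longrightarrow>
      jet_class (material_shift U \<kappa> (base_map \<kappa> y - base_map \<kappa> x)) x \<in> material_groupoid B W"
    using U(2) unfolding homogeneous_on_def by blast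
  obtain V where iso: "principal_iso U V \<kappa>"
    using principal_embedding_iso U(1) \<kappa> unfolding deformation_def by blast
  obtain \<kappa>' where \<kappa>': "deformation U' \<kappa>'" and wrt: "\<And>x. x \<in> U' \<Longrightarrow>
      jet1 (material_frame U' \<kappa>' x) e1 \<in> crystal_structure B W Z\<^sub>0"
    using U'(2) unfolding homogeneous_wrt_on_def by blast
  obtain V' where iso': "principal_iso U' V' \<kappa>'"
    using principal_embedding_iso U'(1) \<kappa>' unfolding deformation_def by blast
  obtain Y\<^sub>0 D\<^sub>0 where Z0: "Z\<^sub>0 = (e1, Y\<^sub>0, D\<^sub>0)" using Z by (rule second_frame_bundleE)
  define v where "v = base_map \<kappa> y - base_map \<kappa> x"
  define \<Psi> where "\<Psi> = material_shift U \<kappa> v"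
  define D where "D = {u \<in> U. base_map \<kappa> u + v \<in> V}"
  obtain S where s: "principal_iso D S \<Psi>" and SU: "S \<subseteq> U"
    and shift: "\<forall>u\<in>D. base_map \<kappa> (base_map \<Psi> u) = base_map \<kappa> u + v"
    unfolding \<Psi>_def D_def by (rule principal_iso_material_shift[OF iso, where v = v])
  \<comment> \<open>\<open>\<Psi>\<close> is controlled over \<open>D\<close> and
    \<open>\<kappa>'\<close> over \<open>U'\<close>; their intersection still contains
    \<open>x\<close>.\<close>
  define D' where "D' = D \<inter> U'"
  define E where "E = base_map \<Psi> ` D'"
  define \<Psi>i where "\<Psi>i = inv_into (frame_bundle D') \<Psi>"
  define \<mu> where "\<mu> = \<kappa>' \<circ> \<Psi>i"
  have D': "open D'" "D' \<subseteq> D" "D' \<subseteq> U'"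
    using principal_iso_open(1)[OF s] U'(1) by (auto simp: D'_def)
  have r: "principal_iso D' E \<Psi>"
    unfolding E_def by (rule principal_iso_restrict[OF s D'(1,2)])
  have ri: "principal_iso E D' \<Psi>i"
    unfolding \<Psi>i_def by (rule principal_iso_inverse[OF r])
  have r': "principal_iso D' (base_map \<kappa>' ` D') \<kappa>'"
    by (rule principal_iso_restrict[OF iso' D'(1,3)])
  have l: "principal_iso E (base_map \<kappa>' ` D') \<mu>"
    unfolding \<mu>_def by (rule principal_iso_compose[OF ri r'])
  have EU: "E \<subseteq> U" using SU base_map_mem[OF s] D'(2) by (auto simp: E_def)
  \<comment> \<open>The base map of \<open>\<kappa>\<close> is injective and takes the same value at
    \<open>y\<close> and at the shifted \<open>x\<close>.\<close>
  have "y \<in> E"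
  proof -
    have xD: "x \<in> D" using U(3,4) base_map_mem[OF iso] by (simp add: D_def v_def)
    then have "base_map \<kappa> (base_map \<Psi> x) = base_map \<kappa> y" using shift by (simp add: v_def)
    moreover have "base_map \<Psi> x \<in> U" using base_map_mem[OF s xD] SU by blast
    ultimately have "base_map \<Psi> x = y" using base_map_inverse[OF iso] U(4) by metis
    then show ?thesis using xD U'(3) by (auto simp: E_def D'_def)
  qed
  have crystal: "jet1 (material_frame E \<mu> z) e1 \<in> crystal_structure B W Z\<^sub>0" if z: "z \<in> E" for z
  proof -
    obtain u where u: "u \<in> D'" "z = base_map \<Psi> u" using z by (auto simp: E_def)
    have uU: "u \<in> U'" "u \<in> D" "u \<in> U" using u D' by (auto simp: D_def)
    have "base_map \<Psi>i z = u"
      using base_map_inverse[OF r u(1)] by (simp add: \<Psi>i_def u(2))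
    then have lz: "base_map \<mu> z = base_map \<kappa>' u"
      using base_map_compose[OF ri r' z] u(1) by (simp add: \<mu>_def)
    let ?c = "base_map \<kappa>' u"
    define f where "f = material_frame U' \<kappa>' u"
    let ?N = "frame_bundle {w. w + ?c \<in> base_map \<kappa>' ` D'}"
    have "continuous_on UNIV (translation ?c)" by (intro continuous_intros)
    from open_vimage[OF principal_iso_open(2)[OF r'] this]
    have "open {w. w + ?c \<in> base_map \<kappa>' ` D'}" by (simp add: vimage_def)
    then have o: "open ?N" by (rule open_frame_bundle)
    have e: "e1 \<in> ?N" using u(1) by (intro e1_mem) simp
    \<comment> \<open>Both sides use the same translation, since \<open>\<mu>\<close> at
      \<open>z\<close> and \<open>\<kappa>'\<close> at \<open>u\<close> have the same base value,
      and near \<open>e1\<close> the inverse of \<open>\<mu>\<close> is \<open>\<Psi>\<close> after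
      the inverse of \<open>\<kappa>'\<close>.\<close>
    have "jet1 (material_frame E \<mu> z) e1 = jet1 (\<Psi> \<circ> f) e1"
    proof (rule jet1_cong_open[OF o e])
      fix Y assume "Y \<in> ?N"
      then have Q: "(fst Y + ?c, snd Y) \<in> frame_bundle (base_map \<kappa>' ` D')" (is "?Q \<in> _")
        by (simp add: mem_frame_bundle)
      define R where "R = inv_into (frame_bundle D') \<kappa>' ?Q"
      have R: "R \<in> frame_bundle D'" "\<kappa>' R = ?Q"
        using principal_iso_inv_into[OF r'] Q by (simp_all add: R_def)
      then have "R \<in> frame_bundle U'" using frame_bundle_mono[OF D'(3)] by blast
      then have 1: "inv_into (frame_bundle U') \<kappa>' ?Q = R"
        using principal_iso_inv_into(1)[OF iso'] R(2) by metis
      have "\<mu> (\<Psi> R) = ?Q"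
        using principal_iso_inv_into(1)[OF r R(1)] R(2) by (simp add: \<mu>_def \<Psi>i_def)
      then have "inv_into (frame_bundle E) \<mu> ?Q = \<Psi> R"
        using principal_iso_inv_into(1)[OF l principal_iso_mem[OF r R(1)]] by metis
      with 1 show "material_frame E \<mu> z Y = (\<Psi> \<circ> f) Y"
        by (simp add: f_def lz frame_lift_translation_eq)
    qed
    moreover
    obtain N where N: "0 \<in> N" "principal_iso N U' f"
      unfolding f_def using principal_iso_material_frame[OF iso' uU(1)] .
    have X: "f e1 \<in> frame_bundle {u}" unfolding f_def by (rule material_frame_e1[OF iso' uU(1)])
    then have XD: "f e1 \<in> frame_bundle D" using uU(2) by (simp add: mem_frame_bundle)
    note jet1_compose[OF N(2) s e1_mem[OF N(1)] XD]
    moreover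
    \<comment> \<open>The vector \<open>v\<close> is also the displacement from \<open>u\<close> to
      its own image, so homogeneity applied to this pair makes the jet of \<open>\<Psi>\<close> at
      \<open>u\<close> material.\<close>
    have "base_map \<kappa> (base_map \<Psi> u) - base_map \<kappa> u = v" using shift uU(2) by simp
    then have "jet_class \<Psi> u \<in> material_groupoid B W"
      using hom[OF uU(3), of "base_map \<Psi> u"] EU z u(2) by (auto simp: \<Psi>_def)
    then have J: "(f e1, \<Psi> (f e1), frechet_derivative \<Psi> (at (f e1))) \<in> \<Union>(material_groupoid B W)"
      using X by (auto simp: jet_class_def jet1_def)
    obtain G where G: "frechet_derivative f (at e1) = G \<circ> D\<^sub>0"
      "(Y\<^sub>0, f e1, G) \<in> \<Union>(material_groupoid B W)"
      using wrt[OF uU(1)] unfolding Z0 crystal_structure_iff[OF wide] f_def jet1_def by blast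
    ultimately have "jet1 (material_frame E \<mu> z) e1 =
        (e1, \<Psi> (f e1), (frechet_derivative \<Psi> (at (f e1)) \<circ> G) \<circ> D\<^sub>0)"
      by (simp only: comp_assoc)
    then show ?thesis
      unfolding Z0 crystal_structure_iff[OF wide] using jets_compose[OF wide G(2) J] by blast
  qed
  have "homogeneous_wrt_on B W Z\<^sub>0 E"
    unfolding homogeneous_wrt_on_def deformation_def
    using principal_iso_embedding[OF l] crystal by blast
  with principal_iso_open(2)[OF r] \<open>y \<in> E\<close> EU show thesis by (rule that)
qed

text \<open>By transport, a member of the cover that meets the set \<open>S\<close> of good points
  lies in \<open>S\<close>. Hence members meeting \<open>S\<close> and members missing it split
  \<open>B\<close> into disjoint open parts, and connectedness leaves only the part containing
  \<open>z\<close>.\<close>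

lemma locally_homogeneous_imp_wrt:
  fixes B :: "(real^'n::finite) set"
  assumes wide: "wide_subgroupoid B (material_groupoid B W)"
    and B: "connected B" "B \<noteq> {}" and hom: "locally_homogeneous B W"
  shows "\<exists>Z\<^sub>0 \<in> second_frame_bundle B. locally_homogeneous_wrt B W Z\<^sub>0"
proof -
  obtain \<U> where \<U>: "\<And>U. U \<in> \<U> \<Longrightarrow> open U \<and> U \<subseteq> B \<and> homogeneous_on B W U" "\<Union>\<U> = B"
    using hom unfolding locally_homogeneous_def by blast
  obtain z U where z: "z \<in> U" "U \<in> \<U>" using B(2) \<U>(2) by blast
  obtain Z\<^sub>0 where Z: "Z\<^sub>0 \<in> second_frame_bundle B" "homogeneous_wrt_on B W Z\<^sub>0 U"
    using homogeneous_imp_wrt[OF wide] \<U>(1)[OF z(2)] z(1) by metis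
  define S where "S = {x. \<exists>U. open U \<and> x \<in> U \<and> U \<subseteq> B \<and> homogeneous_wrt_on B W Z\<^sub>0 U}"
  define P where "P = \<Union>{U \<in> \<U>. U \<inter> S \<noteq> {}}"
  define Q where "Q = \<Union>{U \<in> \<U>. U \<inter> S = {}}"
  have "z \<in> S" unfolding S_def using Z(2) z \<U>(1) by blast
  then have zP: "z \<in> P" using z by (auto simp: P_def)
  have sub: "y \<in> S" if U: "U \<in> \<U>" "x \<in> U" "x \<in> S" "y \<in> U" for U x y
  proof -
    obtain U' where U': "open U'" "x \<in> U'" "homogeneous_wrt_on B W Z\<^sub>0 U'"
      using U(3) unfolding S_def by blast
    have o: "open U" "U \<subseteq> B" "homogeneous_on B W U" using \<U>(1)[OF U(1)] by auto
    obtain E where "open E" "y \<in> E" "E \<subseteq> U" "homogeneous_wrt_on B W Z\<^sub>0 E"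
      by (rule homogeneous_wrt_transport[OF wide Z(1) o(1,3) U(2,4) U'(1,3,2)])
    then show ?thesis unfolding S_def using o(2) by blast
  qed
  then have PS: "P \<subseteq> S" unfolding P_def by blast
  have "open P" "open Q" unfolding P_def Q_def using \<U>(1) by (auto intro!: open_Union)
  moreover have "P \<inter> Q \<inter> B = {}" using PS by (auto simp: Q_def)
  moreover have "B \<subseteq> P \<union> Q" unfolding P_def Q_def using \<U>(2) by blast
  ultimately have "P \<inter> B = {} \<or> Q \<inter> B = {}" using connectedD[OF B(1)] by blast
  moreover have "z \<in> B" using z \<U>(2) by blast
  ultimately have "B \<subseteq> S" using zP PS \<open>B \<subseteq> P \<union> Q\<close> by blast
  then show ?thesis
    using Z(1) unfolding locally_homogeneous_wrt_def S_def by blast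
qed

text \<open>A crystal sits at a point of the body, hence \<open>B \<noteq> {}\<close>. Connectedness
  enters where one crystal has to reach all points: different components may admit no material
  isomorphism between them.\<close>

theorem proposition10p8:
  fixes B :: "(real^3) set"
    and W :: "3 jet set \<Rightarrow> 'v::real_normed_vector"
  assumes "open B" and "B \<noteq> {}"
    and "mechanical_response B W"
    and "lie_subgroupoid B (material_groupoid B W)"
  shows "(homogeneous B W \<longleftrightarrow>
            (\<exists>Z\<^sub>0 \<in> second_frame_bundle B. homogeneous_wrt B W Z\<^sub>0)) \<and>
         ((\<exists>Z\<^sub>0 \<in> second_frame_bundle B. locally_homogeneous_wrt B W Z\<^sub>0) \<longrightarrow>
            locally_homogeneous B W) \<and>
         (connected B \<longrightarrow> locally_homogeneous B W \<longrightarrow>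
            (\<exists>Z\<^sub>0 \<in> second_frame_bundle B. locally_homogeneous_wrt B W Z\<^sub>0))"
proof (intro conjI impI)
  have wide: "wide_subgroupoid B (material_groupoid B W)"
    using assms(4) by (simp add: lie_subgroupoid_def)
  show "homogeneous B W \<longleftrightarrow> (\<exists>Z\<^sub>0 \<in> second_frame_bundle B. homogeneous_wrt B W Z\<^sub>0)"
    unfolding homogeneous_def homogeneous_wrt_def
    using homogeneous_imp_wrt[OF wide assms(1) subset_refl] wrt_imp_homogeneous[OF wide assms(1)] assms(2)
    by (metis all_not_in_conv)
  show "\<exists>Z\<^sub>0 \<in> second_frame_bundle B. locally_homogeneous_wrt B W Z\<^sub>0"
    if "connected B" "locally_homogeneous B W"
    using locally_homogeneous_imp_wrt[OF wide that(1) assms(2) that(2)] .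
  assume "\<exists>Z\<^sub>0 \<in> second_frame_bundle B. locally_homogeneous_wrt B W Z\<^sub>0"
  then obtain Z\<^sub>0 where Z: "Z\<^sub>0 \<in> second_frame_bundle B"
    "\<And>x. x \<in> B \<Longrightarrow> \<exists>U. open U \<and> x \<in> U \<and> U \<subseteq> B \<and> homogeneous_wrt_on B W Z\<^sub>0 U"
    unfolding locally_homogeneous_wrt_def by blast
  \<comment> \<open>The same crystal serves on all these sets, and each of them is homogeneous
    through its own deformation.\<close>
  let ?\<U> = "{U. open U \<and> U \<subseteq> B \<and> homogeneous_wrt_on B W Z\<^sub>0 U}"
  have "\<forall>U\<in>?\<U>. open U \<and> U \<subseteq> B \<and> homogeneous_on B W U"
    using wrt_imp_homogeneous[OF wide _ Z(1)] by blast
  moreover have "\<Union>?\<U> = B" using Z(2) by blast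
  ultimately show "locally_homogeneous B W" unfolding locally_homogeneous_def by blast
qed

end
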